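(* Assume that: (C1) $\|\boldsymbol{\mu}\|^2/n=O(1)$; (C2) there exists a positive constant $\kappa_0$ such that $\lambda_{\min}(n^{-1}\mathbf{X}_{M_0+1}^{\top}\mathbf{X}_{M_0+1})\ge\kappa_0$ (for all $n$). Then: (i) If $(k_{M_0+1}-k_1)/(n\eta_n)\to0$ and $M_0/(n\eta_n^2)\to0$, then $\Pr\{\inf_{\mathbf{w}\in\mathcal{H}_n(N)}L_n(\mathbf{w})=L_n(\mathbf{w}_{M_0+1}^0)\}\to1$. (ii) Assume that $\eta_n\ge c_{\tau_0}n^{-\tau_0}$ for a positive constant $c_{\tau_0}$. If $(k_{M_0+1}-k_1)/n^{1-2\tau_0}\to0$ and $M_0/n^{1-4\tau_0}\to0$, then $\Pr\{\inf_{\mathbf{w}\in\mathcal{H}_n^{\delta}}L_n(\mathbf{w})=L_n(\mathbf{w}_{M_0+1}^0)\}\to1$. In particular, if $k_{M_0+1}$ is fixed, then $$\frac{L_n(\mathbf{w}_{M_0+1}^0)}{\inf_{\mathbf{w}\in\mathcal{H}_n(N)}L_n(\mathbf{w})}\to_p1\quad\text{and}\quad\frac{L_n(\mathbf{w}_{M_0+1}^0)}{\inf_{\mathbf{w}\in\mathcal{H}_n^{\delta}}L_n(\mathbf{w})}\to_p1.$$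
   Context: Model. For each sample size $n$, $y_i=\mu_i+e_i$, $\mu_i=\sum_{j=1}^{\infty}\beta_jx_{ij}$, $i=1,\dots,n$, with deterministic covariates $x_{ij}$, unknown coefficients $\beta_j$, and i.i.d. errors $e_i$ with $E(e_i)=0$, $E(e_i^2)=\sigma^2$, and $E|e_i|^{4+\zeta}<\infty$ for some $\zeta>0$. Write $\mathbf{y}=(y_1,\dots,y_n)^{\top}$ and $\boldsymbol{\mu}=(\mu_1,\dots,\mu_n)^{\top}$. Candidate models. There are $M_n$ nested candidate models; the $m$th uses the first $k_m$ covariates, where $0<k_1<\cdots<k_{M_n}<\infty$ are integers. $\mathbf{X}_m$ is the $n\times k_m$ design matrix of the $m$th model, assumed of full column rank, and $\mathbf{P}_m=\mathbf{X}_m(\mathbf{X}_m^{\top}\mathbf{X}_m)^{-1}\mathbf{X}_m^{\top}$. True model. Let $\mathcal{A}_m=\{1,\dots,k_m\}$ and let $\mathcal{A}_m^c$ be its complement. There is an index $M_0$ with $M_0\ge1$ and $M_n>M_0+1$ such that $(\beta_j,\ j\in\mathcal{A}_{M_0+1}\cap\mathcal{A}_{M_0}^c)^{\top}\ne\mathbf{0}$ and $\beta_j=0$ for all $j>k_{M_0+1}$; the $(M_0+1)$th model is the true model. Put $\eta_n=\sum_{j\in\mathcal{A}_{M_0+1}\cap\mathcal{A}_{M_0}^c}\beta_j^2$. $M_n$, $M_0$, the $k_m$ and $\eta_n$ may depend on $n$. "$k_{M_0+1}$ is fixed" means that the true model dimension does not depend on $n$; in that case $\eta_n^{-1}=O(1)$.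 All limits are as $n\to\infty$; $\to_p$ denotes convergence in probability. Weights and loss. $\mathcal{H}_n=\{\mathbf{w}\in[0,1]^{M_n}:\sum_{m=1}^{M_n}w_m=1\}$. For a fixed positive integer $N$, $\mathcal{H}_n(N)=\{\mathbf{w}: w_m\in\{0,1/N,2/N,\dots,1\},\ \sum_{m=1}^{M_n}w_m=1\}$. Further, $\mathcal{H}_n^{\delta}=\{\mathbf{w}\in\mathcal{H}_n:\sum_{m<M_0+1}w_m=0\ \text{or}\ \sum_{m<M_0+1}w_m\ge\delta n^{-\tau_0}\}$, where $\delta$ is a positive constant which can be arbitrarily small and $\tau_0$ is a positive constant satisfying $\eta_n\ge c_{\tau_0}n^{-\tau_0}$ for a positive constant $c_{\tau_0}$. The loss is $L_n(\mathbf{w})=\|\boldsymbol{\mu}-\sum_{m=1}^{M_n}w_m\mathbf{P}_m\mathbf{y}\|^2$, and $\mathbf{w}_m^0$ is the $M_n\times1$ vector whose $m$th element is one and whose other elements are zero. $\lambda_{\min}$ denotes the minimum eigenvalue, $\|\cdot\|$ the Euclidean norm.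
   Formalization: In the final claim, the second ratio (over the set H_n^δ) is stated only for τ_0<1/2, since it fails for larger τ_0 (e.g. orthogonal design, Gaussian errors); and a ratio 0/0 of losses is read as 1. *)

theory Defs
  imports
    "HOL-Probability.Probability"
    "HOL-Library.Landau_Symbols"
    "Jordan_Normal_Form.DL_Rank"
    "Jordan_Normal_Form.Gauss_Jordan_Elimination"
    "Jordan_Normal_Form.Spectral_Radius"
begin

text \<open>
  Observations \<open>i\<close>, covariates \<open>j\<close> and candidate models \<open>m\<close> are numbered from 1; vectors and
  matrices are indexed from 0, whence the shifts by \<^const>\<open>Suc\<close>.
  Unless stated otherwise, the functions below describe one sample size: \<open>x i j\<close> are the
  covariates, \<open>\<beta> j\<close> the coefficients, \<open>k m\<close> the model dimensions, \<open>Mn\<close> the number of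
  candidate models, and \<open>M0 + 1\<close> is the index of the true model.
\<close>

definition enorm :: "real vec \<Rightarrow> real" where
  "enorm v = L2_set (\<lambda>i. vec_index v i) {..<dim_vec v}"

definition lambda_min :: "real mat \<Rightarrow> real" where
  "lambda_min A = Min (spectrum A)"

definition design :: "(nat \<Rightarrow> nat \<Rightarrow> real) \<Rightarrow> nat \<Rightarrow> nat \<Rightarrow> real mat" where
  "design x n p = mat n p (\<lambda>(i, j). x (Suc i) (Suc j))"

text \<open>The value is the orthogonal projection only if \<open>X\<close> has full column rank.\<close>

definition hat_matrix :: "real mat \<Rightarrow> real mat" where
  "hat_matrix X = X * the (mat_inverse (transpose_mat X * X)) * transpose_mat X"

definition mean_vec :: "(nat \<Rightarrow> nat \<Rightarrow> real) \<Rightarrow> (nat \<Rightarrow> real) \<Rightarrow> nat \<Rightarrow> real vec" where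
  "mean_vec x \<beta> n = vec n (\<lambda>i. \<Sum>j. \<beta> (Suc j) * x (Suc i) (Suc j))"

definition response ::
    "(nat \<Rightarrow> nat \<Rightarrow> real) \<Rightarrow> (nat \<Rightarrow> real) \<Rightarrow> (nat \<Rightarrow> 'a \<Rightarrow> real) \<Rightarrow> nat \<Rightarrow> 'a \<Rightarrow> real vec" where
  "response x \<beta> e n \<omega> = mean_vec x \<beta> n + vec n (\<lambda>i. e (Suc i) \<omega>)"

definition averaged_fit ::
    "(nat \<Rightarrow> nat \<Rightarrow> real) \<Rightarrow> (nat \<Rightarrow> nat) \<Rightarrow> nat \<Rightarrow> nat \<Rightarrow> (nat \<Rightarrow> real) \<Rightarrow> real vec \<Rightarrow> real vec" where
  "averaged_fit x k Mn n w y =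
     vec n (\<lambda>i. \<Sum>m\<in>{1..Mn}. w m * vec_index (hat_matrix (design x n (k m)) *\<^sub>v y) i)"

definition loss ::
    "(nat \<Rightarrow> nat \<Rightarrow> real) \<Rightarrow> (nat \<Rightarrow> real) \<Rightarrow> (nat \<Rightarrow> nat) \<Rightarrow> nat \<Rightarrow> (nat \<Rightarrow> 'a \<Rightarrow> real) \<Rightarrow>
     nat \<Rightarrow> (nat \<Rightarrow> real) \<Rightarrow> 'a \<Rightarrow> real" where
  "loss x \<beta> k Mn e n w \<omega> =
     (enorm (mean_vec x \<beta> n - averaged_fit x k Mn n w (response x \<beta> e n \<omega>)))\<^sup>2"

definition weights :: "nat \<Rightarrow> (nat \<Rightarrow> real) set" where
  "weights Mn = {w \<in> {1..Mn} \<rightarrow>\<^sub>E {0..1}. (\<Sum>m\<in>{1..Mn}. w m) = 1}"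

definition discrete_weights :: "nat \<Rightarrow> nat \<Rightarrow> (nat \<Rightarrow> real) set" where
  "discrete_weights N Mn =
     {w \<in> {1..Mn} \<rightarrow>\<^sub>E {real l / real N | l. l \<le> N}. (\<Sum>m\<in>{1..Mn}. w m) = 1}"

definition delta_weights :: "real \<Rightarrow> real \<Rightarrow> nat \<Rightarrow> nat \<Rightarrow> nat \<Rightarrow> (nat \<Rightarrow> real) set" where
  "delta_weights \<delta> \<tau> M0 Mn n =
     {w \<in> weights Mn. (\<Sum>m\<in>{1..<M0+1}. w m) = 0 \<or> (\<Sum>m\<in>{1..<M0+1}. w m) \<ge> \<delta> * real n powr (- \<tau>)}"

definition unit_weight :: "nat \<Rightarrow> nat \<Rightarrow> nat \<Rightarrow> real" where
  "unit_weight Mn m = (\<lambda>l\<in>{1..Mn}. if l = m then 1 else 0)"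

definition true_block :: "(nat \<Rightarrow> nat) \<Rightarrow> nat \<Rightarrow> nat set" where
  "true_block k M0 = {1..k (M0 + 1)} \<inter> - {1..k M0}"

definition eta :: "(nat \<Rightarrow> real) \<Rightarrow> (nat \<Rightarrow> nat) \<Rightarrow> nat \<Rightarrow> real" where
  "eta \<beta> k M0 = (\<Sum>j\<in>true_block k M0. (\<beta> j)\<^sup>2)"

definition nested_candidates :: "(nat \<Rightarrow> nat \<Rightarrow> real) \<Rightarrow> (nat \<Rightarrow> nat) \<Rightarrow> nat \<Rightarrow> nat \<Rightarrow> bool" where
  "nested_candidates x k Mn n \<longleftrightarrow>
     0 < k 1 \<and> strict_mono_on {1..Mn} k \<and>
     (\<forall>m\<in>{1..Mn}. vec_space.rank n (design x n (k m)) = k m)"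

definition true_model :: "(nat \<Rightarrow> real) \<Rightarrow> (nat \<Rightarrow> nat) \<Rightarrow> nat \<Rightarrow> nat \<Rightarrow> bool" where
  "true_model \<beta> k M0 Mn \<longleftrightarrow>
     1 \<le> M0 \<and> M0 + 1 < Mn \<and> (\<exists>j\<in>true_block k M0. \<beta> j \<noteq> 0) \<and> (\<forall>j>k (M0 + 1). \<beta> j = 0)"

definition iid_errors :: "'a measure \<Rightarrow> (nat \<Rightarrow> 'a \<Rightarrow> real) \<Rightarrow> real \<Rightarrow> bool" where
  "iid_errors M e \<sigma> \<longleftrightarrow>
     prob_space.indep_vars M (\<lambda>_. borel) e {1..} \<and>
     (\<forall>i\<ge>1. distr M borel (e i) = distr M borel (e 1)) \<and>
     (\<forall>i\<ge>1. prob_space.expectation M (e i) = 0) \<and>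
     (\<forall>i\<ge>1. prob_space.expectation M (\<lambda>\<omega>. (e i \<omega>)\<^sup>2) = \<sigma>\<^sup>2) \<and>
     (\<exists>\<zeta>>0. \<forall>i\<ge>1. integrable M (\<lambda>\<omega>. \<bar>e i \<omega>\<bar> powr (4 + \<zeta>)))"

text \<open>
  A quotient of losses, with \<open>0/0\<close> read as \<open>1\<close>: both losses can vanish with probability
  bounded away from 0 if the errors have an atom at 0. For \<open>a > 0\<close> the quotient \<open>a/0\<close> is \<open>0\<close>
  here, which also counts as a deviation from \<open>1\<close>.
\<close>

definition loss_ratio :: "real \<Rightarrow> real \<Rightarrow> real" where
  "loss_ratio a b = (if a = 0 \<and> b = 0 then 1 else a / b)"

text \<open>
  Measurability for large \<open>n\<close> is part of the notion, because \<^const>\<open>measure\<close> is 0 on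
  sets that are not measurable.
\<close>

definition tendsto_in_prob :: "'a measure \<Rightarrow> (nat \<Rightarrow> 'a \<Rightarrow> real) \<Rightarrow> real \<Rightarrow> bool" where
  "tendsto_in_prob M X c \<longleftrightarrow>
     (\<forall>\<^sub>F n in sequentially. X n \<in> borel_measurable M) \<and>
     (\<forall>\<epsilon>>0. (\<lambda>n. \<P>(\<omega> in M. \<bar>X n \<omega> - c\<bar> > \<epsilon>)) \<longlonglongrightarrow> 0)"

end

theory Submission
  imports Defs "HOL-Real_Asymp.Real_Asymp"
begin

text \<open>
  Write \<open>T = M0 + 1\<close>, let \<open>P j\<close> be the projection of the \<open>j\<close>th candidate and
  \<open>D j = P j - P (j - 1)\<close>, with \<open>P 0 = 0\<close>. The models are nested, so the \<open>D j\<close> are mutually orthogonal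
  projections. Put \<open>U j = \<Sum>m<j. w m\<close>. Because \<open>P T \<mu> = \<mu>\<close>, the component of
  \<open>\<mu> - \<Sum>m. w m P m y\<close> in the range of \<open>D j\<close>, \<open>j \<le> T\<close>, is \<open>U j D j \<mu> - (1 - U j) D j e\<close>,
  while the loss of the true model is the sum of the \<open>|D j e|\<^sup>2\<close> over \<open>j \<le> T\<close>. Expanding the
  squares and dropping the components beyond \<open>T\<close> gives, with \<open>u = U T\<close>,

    \<open>L(w) - L(w\<^sub>T) \<ge> u (u |D T \<mu>|\<^sup>2 - 2 \<Sum>\<bar>\<langle>D j \<mu>, e\<rangle>\<bar> - 2 \<Sum>|D j e|\<^sup>2)\<close>,

  where \<open>j\<close> runs over \<open>2..T\<close> (lemma \<open>loss_gap\<close>). So the true model is optimal among all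
  weights with \<open>u = 0\<close> or \<open>u \<ge> u0\<close> as soon as the two noise terms are small compared
  with \<open>u0 |D T \<mu>|\<^sup>2\<close>.

  The signal \<open>|D T \<mu>|\<^sup>2\<close> is at least \<open>n \<kappa> \<eta>\<close>: it equals \<open>|X v|\<^sup>2\<close> for the design matrix
  \<open>X\<close> of the true model and a vector \<open>v\<close> that agrees with \<open>\<beta>\<close> on the last block, and the
  Rayleigh bound applies (\<open>true_signal_lower_bound\<close>, \<open>lambda_min_le_quadratic_form\<close>). The
  noise term \<open>\<Sum>|D j e|\<^sup>2\<close> has expectation \<open>\<sigma>\<^sup>2 (k T - k 1)\<close>, a trace, and by
  Cauchy-Schwarz the square of \<open>\<Sum>\<bar>\<langle>D j \<mu>, e\<rangle>\<bar>\<close> is at most \<open>M0\<close> times a sum with expectation at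
  most \<open>\<sigma>\<^sup>2 |\<mu>|\<^sup>2\<close>. Markov's inequality then bounds the probability of failure explicitly
  (\<open>prob_true_model_optimal\<close>). The theorem follows with \<open>u0 = 1/N\<close> for the discrete weights
  and \<open>u0 = \<delta> n powr (- \<tau>0)\<close> for the restricted continuous ones.

  The infimum over the uncountable weight set is measurable because the loss is continuous in the
  weights, so that a countable dense subset has the same infimum.
\<close>

section \<open>Hat matrices\<close>

text \<open>The Euclidean inner product of real vectors.\<close>

abbreviation ip :: "real vec \<Rightarrow> real vec \<Rightarrow> real" where
  "ip u v \<equiv> scalar_prod u v"

lemma enorm_square: "(enorm v)\<^sup>2 = ip v v"
  by (simp add: enorm_def L2_set_def scalar_prod_def power2_eq_square sum_nonneg
      flip: atLeast0LessThan)

lemma ip_self_nonneg: "0 \<le> ip v v"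
  using enorm_square[of v] by (metis zero_le_power2)

lemma ip_self_eq_0_iff:
  assumes "v \<in> carrier_vec n" shows "ip v v = 0 \<longleftrightarrow> v = 0\<^sub>v n"
proof
  assume "ip v v = 0"
  then have "\<forall>i\<in>{0..<n}. vec_index v i * vec_index v i = 0"
    using assms by (subst (asm) scalar_prod_def, subst (asm) sum_nonneg_eq_0_iff) auto
  then show "v = 0\<^sub>v n" using assms by (intro eq_vecI) auto
qed (use assms in simp)

lemma ip_transpose:
  assumes "A \<in> carrier_mat n k" "u \<in> carrier_vec n" "v \<in> carrier_vec k"
  shows "ip u (A *\<^sub>v v) = ip (transpose_mat A *\<^sub>v u) v"
  using transpose_vec_mult_scalar[OF assms(1,3,2)] assms
  by (metis comm_scalar_prod mult_mat_vec_carrier transpose_carrier_mat)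

lemma full_rank_kernel_trivial:
  fixes X :: "real mat"
  assumes X: "X \<in> carrier_mat n k" and rank: "vec_space.rank n X = k"
    and v: "v \<in> carrier_vec k" "X *\<^sub>v v = 0\<^sub>v n"
  shows "v = 0\<^sub>v k"
proof -
  interpret vec_space "TYPE(real)" n .
  have "distinct (cols X)"
  proof (rule ccontr)
    assume nd: "\<not> distinct (cols X)"
    obtain S where S: "maximal S (\<lambda>T. T \<subseteq> set (cols X) \<and> lin_indpt T)"
      using maximal_exists[of "(\<lambda>T. T \<subseteq> set (cols X) \<and> lin_indpt T)" "card (set (cols X))" "{}"]
      by (meson List.finite_set card_mono empty_iff empty_subsetI finite_lin_indpt2 rev_finite_subset)
    then have "card S \<le> card (set (cols X))" by (simp add: card_mono maximal_def)
    moreover have "card (set (cols X)) < k"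
      using nd X card_distinct card_length[of "cols X"] by (metis carrier_matD(2) cols_length nat_less_le)
    ultimately show False using rank_card_indpt[OF X S] rank by simp
  qed
  then show ?thesis
    using full_rank_lin_indpt[OF X rank] lin_depI[OF X v(1) _ v(2)] by blast
qed

lemma gram_inverse:
  fixes X :: "real mat"
  assumes X: "X \<in> carrier_mat n k" and rank: "vec_space.rank n X = k"
  obtains B where "mat_inverse (transpose_mat X * X) = Some B" "B \<in> carrier_mat k k"
    "B * (transpose_mat X * X) = 1\<^sub>m k" "transpose_mat X * X * B = 1\<^sub>m k"
proof -
  let ?G = "transpose_mat X * X"
  have G: "?G \<in> carrier_mat k k" using X by simp
  have "det ?G \<noteq> 0"
  proof
    assume "det ?G = 0"
    then obtain v where v: "v \<in> carrier_vec k" "v \<noteq> 0\<^sub>v k" "?G *\<^sub>v v = 0\<^sub>v k"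
      using det_0_iff_vec_prod_zero_field[OF G] by blast
    have "ip (X *\<^sub>v v) (X *\<^sub>v v) = ip (?G *\<^sub>v v) v"
      using X v by (subst ip_transpose[where k = k and n = n]) auto
    then have "X *\<^sub>v v = 0\<^sub>v n"
      using v X by (subst ip_self_eq_0_iff[symmetric]) auto
    then show False using full_rank_kernel_trivial[OF X rank v(1)] v(2) by simp
  qed
  then have "?G \<in> Units (ring_mat TYPE(real) k ())"
    by (rule det_non_zero_imp_unit[OF G])
  then obtain B where "mat_inverse ?G = Some B"
    using mat_inverse(1)[OF G, of "()"] by blast
  then show ?thesis using mat_inverse(2)[OF G] that by blast
qed

lemma trace_mult_comm:
  fixes A B :: "real mat"
  assumes "A \<in> carrier_mat n k" "B \<in> carrier_mat k n"
  shows "(\<Sum>i<n. (A * B) $$ (i, i)) = (\<Sum>j<k. (B * A) $$ (j, j))"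
proof -
  have "(\<Sum>i<n. (A * B) $$ (i, i)) = (\<Sum>i<n. \<Sum>j<k. A $$ (i, j) * B $$ (j, i))"
    using assms by (auto intro!: sum.cong simp: scalar_prod_def atLeast0LessThan)
  also have "\<dots> = (\<Sum>j<k. \<Sum>i<n. B $$ (j, i) * A $$ (i, j))"
    by (subst sum.swap) (simp add: mult.commute)
  also have "\<dots> = (\<Sum>j<k. (B * A) $$ (j, j))"
    using assms by (auto intro!: sum.cong simp: scalar_prod_def atLeast0LessThan)
  finally show ?thesis .
qed

text \<open>
  Full column rank makes the Gram matrix invertible, so that the hat matrix is the orthogonal
  projection onto the column space; its trace is the dimension of that space.
\<close>

lemma hat_matrix_projection:
  assumes X: "X \<in> carrier_mat n k" and rank: "vec_space.rank n X = k"
  shows hat_matrix_carrier: "hat_matrix X \<in> carrier_mat n n"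
    and hat_matrix_symmetric: "transpose_mat (hat_matrix X) = hat_matrix X"
    and hat_matrix_fixes: "hat_matrix X * X = X"
    and hat_matrix_range: "\<exists>C\<in>carrier_mat k n. hat_matrix X = X * C"
    and hat_matrix_trace: "(\<Sum>i<n. hat_matrix X $$ (i, i)) = real k"
proof -
  let ?G = "transpose_mat X * X"
  obtain B where B: "mat_inverse ?G = Some B" "B \<in> carrier_mat k k"
    "B * ?G = 1\<^sub>m k" "?G * B = 1\<^sub>m k"
    using gram_inverse[OF X rank] .
  have G: "?G \<in> carrier_mat k k" and Xt: "transpose_mat X \<in> carrier_mat k n" using X by auto
  have H: "hat_matrix X = X * (B * transpose_mat X)"
    using B X assoc_mult_mat[OF X B(2) Xt] by (simp add: hat_matrix_def)
  have BX: "B * transpose_mat X \<in> carrier_mat k n" using B(2) Xt by simp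
  show "hat_matrix X \<in> carrier_mat n n" using X BX unfolding H by simp
  show "\<exists>C\<in>carrier_mat k n. hat_matrix X = X * C" using H BX by blast
  have BXX: "B * transpose_mat X * X = 1\<^sub>m k"
    using B X by (metis assoc_mult_mat transpose_carrier_mat)
  show "hat_matrix X * X = X"
    unfolding H using BXX X BX by (metis assoc_mult_mat right_mult_one_mat)
  have "transpose_mat B = transpose_mat B * (?G * B)" using B by simp
  also have "\<dots> = transpose_mat B * transpose_mat ?G * B"
    using B(2) G Xt X by (simp add: transpose_mult[OF Xt X] assoc_mult_mat[where n\<^sub>1=k and n\<^sub>2=k and n\<^sub>3=k and n\<^sub>4=k])
  also have "transpose_mat B * transpose_mat ?G = 1\<^sub>m k"
    using transpose_mult[OF G B(2)] B(4) by (metis transpose_one)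
  finally have "transpose_mat B = B" using B(2) by simp
  then show "transpose_mat (hat_matrix X) = hat_matrix X"
    using B(2) X Xt BX by (simp add: H transpose_mult[OF X BX] transpose_mult[OF B(2) Xt])
  show "(\<Sum>i<n. hat_matrix X $$ (i, i)) = real k"
    unfolding H using trace_mult_comm[OF X BX] BXX by simp
qed

section \<open>The minimum eigenvalue of a symmetric matrix\<close>

lemma mult_mat_vec_norm_bound:
  fixes A :: "real mat"
  assumes A: "A \<in> carrier_mat n k"
  obtains c where "0 < c" "\<And>v. v \<in> carrier_vec k \<Longrightarrow> ip (A *\<^sub>v v) (A *\<^sub>v v) \<le> c * ip v v"
proof
  let ?c = "\<Sum>i<n. \<Sum>j<k. (A $$ (i, j))\<^sup>2"
  show "0 < ?c + 1" by (simp add: sum_nonneg add_nonneg_pos)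
  fix v :: "real vec" assume v: "v \<in> carrier_vec k"
  have "ip (A *\<^sub>v v) (A *\<^sub>v v) = (\<Sum>i<n. (\<Sum>j<k. A $$ (i, j) * vec_index v j)\<^sup>2)"
    using A v by (auto simp: scalar_prod_def power2_eq_square atLeast0LessThan intro!: sum.cong)
  also have "\<dots> \<le> (\<Sum>i<n. (\<Sum>j<k. (A $$ (i, j))\<^sup>2) * (\<Sum>j<k. (vec_index v j)\<^sup>2))"
    by (intro sum_mono Cauchy_Schwarz_ineq_sum)
  also have "\<dots> = ?c * ip v v"
    using v by (simp add: sum_distrib_right scalar_prod_def power2_eq_square atLeast0LessThan)
  also have "\<dots> \<le> (?c + 1) * ip v v"
    by (simp add: ip_self_nonneg mult_right_mono)
  finally show "ip (A *\<^sub>v v) (A *\<^sub>v v) \<le> (?c + 1) * ip v v" .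
qed

text \<open>
  If \<open>z = A v\<close>, then \<open>\<langle>A (v - s z), v - s z\<rangle> \<ge> 0\<close> for small \<open>s > 0\<close> bounds \<open>\<langle>v, A v\<rangle>\<close> below by a
  multiple of \<open>|z|\<^sup>2\<close>, and the inverse of \<open>A\<close> bounds \<open>|z|\<close> below by a multiple of \<open>|v|\<close>.
\<close>

lemma psd_invertible_coercive:
  fixes A :: "real mat"
  assumes A: "A \<in> carrier_mat k k" and sym: "transpose_mat A = A"
    and psd: "\<And>v. v \<in> carrier_vec k \<Longrightarrow> 0 \<le> ip v (A *\<^sub>v v)"
    and inv: "det A \<noteq> 0"
  obtains c where "0 < c" "\<And>v. v \<in> carrier_vec k \<Longrightarrow> c * ip v v \<le> ip v (A *\<^sub>v v)"
proof -
  obtain B where B: "B \<in> carrier_mat k k" "B * A = 1\<^sub>m k"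
    using det_non_zero_imp_unit[OF A inv, of "()"] unfolding Units_def ring_mat_def by auto
  obtain b where b: "0 < b" "\<And>v. v \<in> carrier_vec k \<Longrightarrow> ip (B *\<^sub>v v) (B *\<^sub>v v) \<le> b * ip v v"
    using mult_mat_vec_norm_bound[OF B(1)] by blast
  obtain a where a: "0 < a" "\<And>v. v \<in> carrier_vec k \<Longrightarrow> ip (A *\<^sub>v v) (A *\<^sub>v v) \<le> a * ip v v"
    using mult_mat_vec_norm_bound[OF A] by blast
  define K where "K = 1 + a"
  have K: "0 < K" using a(1) by (simp add: K_def)
  have main: "1 / (K * b) * ip v v \<le> ip v (A *\<^sub>v v)" if v: "v \<in> carrier_vec k" for v
  proof -
    define z where "z = A *\<^sub>v v"
    define s where "s = 1 / K"
    have z: "z \<in> carrier_vec k" "A *\<^sub>v z \<in> carrier_vec k" using A v by (auto simp: z_def)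
    have vz: "ip v (A *\<^sub>v z) = ip z z"
      using ip_transpose[OF A v z(1)] sym by (simp add: z_def)
    have sm: "s \<cdot>\<^sub>v z \<in> carrier_vec k" "s \<cdot>\<^sub>v (A *\<^sub>v z) \<in> carrier_vec k" using z by auto
    have "A *\<^sub>v (v - s \<cdot>\<^sub>v z) = z - s \<cdot>\<^sub>v (A *\<^sub>v z)"
      using A v z by (simp add: mult_minus_distrib_mat_vec[OF A] z_def mult_mat_vec[OF A])
    then have "0 \<le> ip (v - s \<cdot>\<^sub>v z) (z - s \<cdot>\<^sub>v (A *\<^sub>v z))"
      using psd[of "v - s \<cdot>\<^sub>v z"] v z by simp
    also have "\<dots> = ip v z - 2 * s * ip z z + s\<^sup>2 * ip z (A *\<^sub>v z)"
      using v z sm vz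
      by (simp add: minus_scalar_prod_distrib[where n = k] scalar_prod_minus_distrib[where n = k]
          power2_eq_square algebra_simps)
    finally have 1: "0 \<le> ip v z - 2 * s * ip z z + s\<^sup>2 * ip z (A *\<^sub>v z)" .
    have "0 \<le> ip (z - A *\<^sub>v z) (z - A *\<^sub>v z)" by (rule ip_self_nonneg)
    also have "\<dots> = ip z z - 2 * ip z (A *\<^sub>v z) + ip (A *\<^sub>v z) (A *\<^sub>v z)"
      using z comm_scalar_prod[OF z]
      by (simp add: minus_scalar_prod_distrib[where n = k] scalar_prod_minus_distrib[where n = k])
    also have "\<dots> \<le> ip z z - 2 * ip z (A *\<^sub>v z) + a * ip z z" using a(2)[OF z(1)] by simp
    finally have "2 * ip z (A *\<^sub>v z) \<le> K * ip z z" by (simp add: K_def algebra_simps)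
    moreover have "0 \<le> ip z (A *\<^sub>v z)" by (rule psd[OF z(1)])
    ultimately have "ip z (A *\<^sub>v z) \<le> K * ip z z" by linarith
    then have "s\<^sup>2 * ip z (A *\<^sub>v z) \<le> s\<^sup>2 * (K * ip z z)" by (intro mult_left_mono) auto
    also have "\<dots> = s * ip z z" using K by (simp add: s_def power2_eq_square)
    finally have 2: "s * ip z z \<le> ip v z" using 1 by linarith
    have "B *\<^sub>v z = v" unfolding z_def using B A v
      by (metis assoc_mult_mat_vec one_mult_mat_vec)
    then have "ip v v \<le> b * ip z z" using b(2)[OF z(1)] by simp
    then have "1 / (K * b) * ip v v \<le> 1 / (K * b) * (b * ip z z)"
      using K b(1) by (intro mult_left_mono) auto
    also have "\<dots> = s * ip z z" using b(1) by (simp add: s_def)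
    finally show ?thesis using 2 by (simp add: z_def)
  qed
  show ?thesis by (rule that[of "1 / (K * b)"]) (use K b main in auto)
qed

lemma ip_smult_smult:
  assumes "u \<in> carrier_vec n" "v \<in> carrier_vec n"
  shows "ip (c \<cdot>\<^sub>v u) (d \<cdot>\<^sub>v v) = c * d * ip u v"
  using assms by simp

text \<open>
  The Rayleigh bound, without diagonalisation. Let \<open>t\<close> be the infimum of the quadratic form on the
  unit sphere. Then \<open>A - t 1\<close> is positive semidefinite; were it invertible, it would be coercive
  and \<open>t\<close> would not be the infimum. So \<open>t\<close> is an eigenvalue, and hence at least the least one.
\<close>

lemma lambda_min_le_quadratic_form:
  assumes A: "A \<in> carrier_mat k k" and sym: "transpose_mat A = A"
    and v: "v \<in> carrier_vec k"
  shows "lambda_min A * ip v v \<le> ip v (A *\<^sub>v v)"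
proof (cases "v = 0\<^sub>v k")
  case True
  then show ?thesis using A by simp
next
  case False
  define R where "R = {ip u (A *\<^sub>v u) |u. u \<in> carrier_vec k \<and> ip u u = 1}"
  define t where "t = Inf R"
  obtain a where a: "0 < a" "\<And>v. v \<in> carrier_vec k \<Longrightarrow> ip (A *\<^sub>v v) (A *\<^sub>v v) \<le> a * ip v v"
    using mult_mat_vec_norm_bound[OF A] by blast
  have bdd: "bdd_below R"
  proof (rule bdd_belowI)
    fix r assume "r \<in> R"
    then obtain u where u: "u \<in> carrier_vec k" "ip u u = 1" "r = ip u (A *\<^sub>v u)"
      by (auto simp: R_def)
    have Au: "A *\<^sub>v u \<in> carrier_vec k" using A u by simp
    have "0 \<le> ip (u + A *\<^sub>v u) (u + A *\<^sub>v u)" by (rule ip_self_nonneg)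
    also have "\<dots> = ip u u + 2 * r + ip (A *\<^sub>v u) (A *\<^sub>v u)"
      using u Au comm_scalar_prod[OF u(1) Au]
      by (simp add: add_scalar_prod_distrib[where n = k] scalar_prod_add_distrib[where n = k])
    finally show "- (1 + a) \<le> r" using a(2)[OF u(1)] u(2) a(1) by simp
  qed
  have low: "t * ip u u \<le> ip u (A *\<^sub>v u)" if u: "u \<in> carrier_vec k" for u
  proof (cases "u = 0\<^sub>v k")
    case True
    then show ?thesis using A by simp
  next
    case False
    then have pos: "0 < ip u u"
      using ip_self_eq_0_iff[OF u] ip_self_nonneg[of u] by linarith
    define r where "r = 1 / sqrt (ip u u)"
    have r2: "r * r = 1 / ip u u" using pos by (simp add: r_def)
    have "ip (r \<cdot>\<^sub>v u) (r \<cdot>\<^sub>v u) = 1"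
      using pos by (simp only: ip_smult_smult[OF u u] r2) simp
    moreover have "ip (r \<cdot>\<^sub>v u) (A *\<^sub>v (r \<cdot>\<^sub>v u)) = ip u (A *\<^sub>v u) / ip u u"
      using A u r2 by (simp only: mult_mat_vec[OF A u] ip_smult_smult[OF u mult_mat_vec_carrier[OF A u]]) simp
    ultimately have "ip u (A *\<^sub>v u) / ip u u \<in> R"
      unfolding R_def using smult_carrier_vec[of r u k] u
      by (intro CollectI exI[of _ "r \<cdot>\<^sub>v u"] conjI) (simp_all only: simp_thms)
    then have "t \<le> ip u (A *\<^sub>v u) / ip u u" unfolding t_def by (rule cInf_lower[OF _ bdd])
    then show ?thesis using pos by (simp add: field_simps)
  qed
  define C where "C = A - t \<cdot>\<^sub>m 1\<^sub>m k"
  have C: "C \<in> carrier_mat k k" unfolding C_def by (intro minus_carrier_mat) simp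
  have Cv: "C *\<^sub>v u = A *\<^sub>v u - t \<cdot>\<^sub>v u" if "u \<in> carrier_vec k" for u
    using A that unfolding C_def
    by (subst minus_mult_distrib_mat_vec[where nr = k and nc = k]) auto
  have Csym: "transpose_mat C = C"
  proof (rule eq_matI)
    fix i j assume "i < dim_row C" "j < dim_col C"
    then show "transpose_mat C $$ (i, j) = C $$ (i, j)"
      using A arg_cong[OF sym, of "\<lambda>B. B $$ (i, j)"] by (simp add: C_def)
  qed (use A in \<open>simp_all add: C_def\<close>)
  have form: "ip u (C *\<^sub>v u) = ip u (A *\<^sub>v u) - t * ip u u" if u: "u \<in> carrier_vec k" for u
    using A u by (simp add: Cv scalar_prod_minus_distrib[where n = k])
  have "det C = 0"
  proof (rule ccontr)
    assume "det C \<noteq> 0"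
    then obtain c where c: "0 < c" "\<And>u. u \<in> carrier_vec k \<Longrightarrow> c * ip u u \<le> ip u (C *\<^sub>v u)"
      using psd_invertible_coercive[OF C Csym] form low by (metis diff_ge_0_iff_ge)
    have "t + c \<le> Inf R"
    proof (rule cInf_greatest)
      have pos: "0 < ip v v"
        using ip_self_eq_0_iff[OF v] ip_self_nonneg[of v] False by linarith
      define r where "r = 1 / sqrt (ip v v)"
      have r2: "r * r = 1 / ip v v" using pos by (simp add: r_def)
      have "ip (r \<cdot>\<^sub>v v) (r \<cdot>\<^sub>v v) = 1"
        using pos by (simp only: ip_smult_smult[OF v v] r2) simp
      moreover have "r \<cdot>\<^sub>v v \<in> carrier_vec k" using v by simp
      ultimately show "R \<noteq> {}" unfolding R_def by blast
      fix r assume "r \<in> R"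
      then show "t + c \<le> r" using c(2) form by (force simp: R_def)
    qed
    then show False using c(1) by (simp add: t_def)
  qed
  then obtain u where u: "u \<in> carrier_vec k" "u \<noteq> 0\<^sub>v k" "C *\<^sub>v u = 0\<^sub>v k"
    using det_0_iff_vec_prod_zero_field[OF C] by blast
  have "A *\<^sub>v u = t \<cdot>\<^sub>v u"
  proof (rule eq_vecI)
    fix i assume "i < dim_vec (t \<cdot>\<^sub>v u)"
    then show "vec_index (A *\<^sub>v u) i = vec_index (t \<cdot>\<^sub>v u) i"
      using arg_cong[OF u(3), of "\<lambda>w. vec_index w i"] A u(1) by (simp add: Cv)
  qed (use A u in simp)
  then have "t \<in> spectrum A"
    using A u unfolding spectrum_def eigenvalue_def eigenvector_def by auto
  then have "lambda_min A \<le> t"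
    unfolding lambda_min_def using card_finite_spectrum(1)[OF A] by (intro Min_le)
  then show ?thesis
    using low[OF v] mult_right_mono[OF _ ip_self_nonneg[of v], of "lambda_min A" t] by linarith
qed

section \<open>Nested projections and the loss gap\<close>

text \<open>
  An increasing chain \<open>P 1, ..., P K\<close> of orthogonal projections in dimension \<open>n\<close>; idempotence is
  the case \<open>l = m\<close> of the last assumption.
\<close>

locale projection_chain =
  fixes n K :: nat and P :: "nat \<Rightarrow> real mat"
  assumes carrier: "m \<in> {1..K} \<Longrightarrow> P m \<in> carrier_mat n n"
    and sym: "m \<in> {1..K} \<Longrightarrow> transpose_mat (P m) = P m"
    and nested: "1 \<le> l \<Longrightarrow> l \<le> m \<Longrightarrow> m \<le> K \<Longrightarrow> P m * P l = P l"
begin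

text \<open>
  The increments of the chain. Only the indices \<open>j\<close> from 2 on are meaningful; the first
  projection is treated separately.
\<close>

definition D :: "nat \<Rightarrow> real mat" where "D j = P j - P (j - 1)"

lemma nested': assumes "1 \<le> l" "l \<le> m" "m \<le> K" shows "P l * P m = P l"
proof -
  have "P l * P m = transpose_mat (P m * P l)"
    using assms transpose_mult[OF carrier carrier, of m l] by (simp add: sym)
  then show ?thesis using assms by (simp add: nested sym)
qed

lemma P_vec [simp]: "m \<in> {1..K} \<Longrightarrow> v \<in> carrier_vec n \<Longrightarrow> P m *\<^sub>v v \<in> carrier_vec n"
  using carrier mult_mat_vec_carrier by blast

lemma pred_carrier: "j \<in> {2..K} \<Longrightarrow> P (j - 1) \<in> carrier_mat n n"
  by (rule carrier) auto

lemma D_carrier: "j \<in> {2..K} \<Longrightarrow> D j \<in> carrier_mat n n"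
  unfolding D_def by (intro minus_carrier_mat pred_carrier)

lemma D_vec [simp]: "j \<in> {2..K} \<Longrightarrow> v \<in> carrier_vec n \<Longrightarrow> D j *\<^sub>v v \<in> carrier_vec n"
  using D_carrier mult_mat_vec_carrier by blast

lemma D_mult_vec:
  assumes "j \<in> {2..K}" "v \<in> carrier_vec n"
  shows "D j *\<^sub>v v = P j *\<^sub>v v - P (j - 1) *\<^sub>v v"
  unfolding D_def using assms
  by (intro minus_mult_distrib_mat_vec[where nr = n and nc = n] carrier) auto

lemma D_sym:
  assumes "j \<in> {2..K}" shows "transpose_mat (D j) = D j"
proof -
  have j: "j \<in> {1..K}" "j - 1 \<in> {1..K}" using assms by auto
  show ?thesis
    unfolding D_def transpose_minus[OF carrier[OF j(1)] carrier[OF j(2)]] sym[OF j(1)] sym[OF j(2)] ..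
qed

lemma P_P_vec:
  assumes "l \<in> {1..K}" "m \<in> {1..K}" "v \<in> carrier_vec n"
  shows "P l *\<^sub>v (P m *\<^sub>v v) = P (min l m) *\<^sub>v v"
  using assms nested[of m l] nested'[of l m] assoc_mult_mat_vec[OF carrier[OF assms(1)] carrier[OF assms(2)] assms(3)]
  by (cases "l \<le> m") (auto simp: min_def)

lemma D_P_vec:
  assumes "j \<in> {2..K}" "m \<in> {1..K}" "v \<in> carrier_vec n"
  shows "D j *\<^sub>v (P m *\<^sub>v v) = (if j \<le> m then D j *\<^sub>v v else 0\<^sub>v n)"
proof -
  have "j - 1 \<in> {1..K}" "j \<in> {1..K}" using assms by auto
  then have "D j *\<^sub>v (P m *\<^sub>v v) = P (min j m) *\<^sub>v v - P (min (j - 1) m) *\<^sub>v v"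
    using assms by (simp only: D_mult_vec[OF assms(1)] P_P_vec P_vec)
  moreover have "min j m = m \<and> min (j - 1) m = m \<or> j \<le> m \<and> min j m = j \<and> min (j - 1) m = j - 1"
    by auto
  moreover have "P m *\<^sub>v v - P m *\<^sub>v v = 0\<^sub>v n"
    using P_vec[OF assms(2,3)] by (rule minus_cancel_vec)
  moreover have "j \<le> m \<or> min j m = m \<and> min (j - 1) m = m" by auto
  ultimately show ?thesis by (auto simp: D_mult_vec[OF assms(1,3)] min_def)
qed

lemma D_D_vec:
  assumes "j \<in> {2..K}" "v \<in> carrier_vec n"
  shows "D j *\<^sub>v (D j *\<^sub>v v) = D j *\<^sub>v v"
proof -
  have "D j *\<^sub>v (D j *\<^sub>v v) = D j *\<^sub>v (P j *\<^sub>v v) - D j *\<^sub>v (P (j - 1) *\<^sub>v v)"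
    unfolding D_mult_vec[OF assms]
    by (rule mult_minus_distrib_mat_vec[OF D_carrier[OF assms(1)]]; rule P_vec) (use assms in auto)
  moreover have "D j *\<^sub>v (P j *\<^sub>v v) = D j *\<^sub>v v" "D j *\<^sub>v (P (j - 1) *\<^sub>v v) = 0\<^sub>v n"
    by (subst D_P_vec; use assms in auto)+
  ultimately show ?thesis using D_vec[OF assms] by simp
qed

lemma ip_D_D:
  assumes "j \<in> {2..K}" "u \<in> carrier_vec n" "v \<in> carrier_vec n"
  shows "ip (D j *\<^sub>v u) (D j *\<^sub>v v) = ip u (D j *\<^sub>v v)"
  using ip_transpose[OF D_carrier assms(2), of j "D j *\<^sub>v v"] assms by (simp add: D_D_vec D_sym)

lemma ip_P_P:
  assumes "m \<in> {1..K}" "u \<in> carrier_vec n" "v \<in> carrier_vec n"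
  shows "ip (P m *\<^sub>v u) (P m *\<^sub>v v) = ip u (P m *\<^sub>v v)"
  using ip_transpose[OF carrier assms(2), of m "P m *\<^sub>v v"] assms by (simp add: P_P_vec sym)

lemma sum_D:
  assumes T: "1 \<le> T" "T \<le> K" and v: "v \<in> carrier_vec n"
  shows "(\<Sum>j = 2..T. ip (D j *\<^sub>v v) (D j *\<^sub>v v)) = ip v (P T *\<^sub>v v) - ip v (P 1 *\<^sub>v v)"
proof -
  have "(\<Sum>j = 2..T. ip (D j *\<^sub>v v) (D j *\<^sub>v v)) = (\<Sum>j = Suc 1..T. ip v (P j *\<^sub>v v) - ip v (P (j - 1) *\<^sub>v v))"
  proof (rule sum.cong)
    fix j assume "j \<in> {Suc 1..T}"
    then have j: "j \<in> {2..K}" "j \<in> {1..K}" "j - 1 \<in> {1..K}" using T by auto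
    show "ip (D j *\<^sub>v v) (D j *\<^sub>v v) = ip v (P j *\<^sub>v v) - ip v (P (j - 1) *\<^sub>v v)"
      using scalar_prod_minus_distrib[OF v P_vec[OF j(2) v] P_vec[OF j(3) v]]
      by (subst ip_D_D[OF j(1) v v]) (simp only: D_mult_vec[OF j(1) v])
  qed (simp add: numeral_2_eq_2)
  also have "\<dots> = ip v (P T *\<^sub>v v) - ip v (P 1 *\<^sub>v v)"
    using T(1) by (rule sum_telescope'')
  finally show ?thesis .
qed

lemma P_contraction:
  assumes m: "m \<in> {1..K}" and v: "v \<in> carrier_vec n"
  shows "ip v (P m *\<^sub>v v) \<le> ip v v"
proof -
  have "0 \<le> ip (v - P m *\<^sub>v v) (v - P m *\<^sub>v v)" by (rule ip_self_nonneg)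
  also have "\<dots> = ip v v - ip v (P m *\<^sub>v v)"
    using m v ip_P_P[OF m v v] comm_scalar_prod[of v n "P m *\<^sub>v v"]
    by (simp add: minus_scalar_prod_distrib[where n = n] scalar_prod_minus_distrib[where n = n])
  finally show ?thesis by simp
qed

text \<open>The average of the projections of \<open>y\<close> with the weights \<open>w\<close>.\<close>

definition avg :: "(nat \<Rightarrow> real) \<Rightarrow> real vec \<Rightarrow> real vec" where
  "avg w y = vec n (\<lambda>i. \<Sum>m\<in>{1..K}. w m * vec_index (P m *\<^sub>v y) i)"

lemma avg_carrier [simp]: "avg w y \<in> carrier_vec n" by (simp add: avg_def)

lemma mult_avg:
  assumes A: "A \<in> carrier_mat n n" and y: "y \<in> carrier_vec n"
  shows "A *\<^sub>v avg w y = vec n (\<lambda>i. \<Sum>m\<in>{1..K}. w m * vec_index (A *\<^sub>v (P m *\<^sub>v y)) i)"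
proof (rule eq_vecI)
  fix i assume "i < dim_vec (vec n (\<lambda>i. \<Sum>m\<in>{1..K}. w m * vec_index (A *\<^sub>v (P m *\<^sub>v y)) i))"
  then have i: "i < n" by simp
  have "vec_index (A *\<^sub>v avg w y) i = (\<Sum>j<n. A $$ (i, j) * (\<Sum>m\<in>{1..K}. w m * vec_index (P m *\<^sub>v y) j))"
    using A i by (simp add: scalar_prod_def avg_def atLeast0LessThan)
  also have "\<dots> = (\<Sum>m\<in>{1..K}. w m * (\<Sum>j<n. A $$ (i, j) * vec_index (P m *\<^sub>v y) j))"
    by (simp add: sum_distrib_left mult.left_commute) (rule sum.swap)
  also have "\<dots> = (\<Sum>m\<in>{1..K}. w m * vec_index (A *\<^sub>v (P m *\<^sub>v y)) i)"
  proof (rule sum.cong, rule refl)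
    fix m assume "m \<in> {1..K}"
    then have "P m *\<^sub>v y \<in> carrier_vec n" using y by simp
    then obtain z where z: "z = P m *\<^sub>v y" "z \<in> carrier_vec n" by simp
    show "w m * (\<Sum>j<n. A $$ (i, j) * vec_index (P m *\<^sub>v y) j) = w m * vec_index (A *\<^sub>v (P m *\<^sub>v y)) i"
      unfolding z(1)[symmetric] using A i z(2) by (simp add: scalar_prod_def atLeast0LessThan)
  qed
  finally show "vec_index (A *\<^sub>v avg w y) i =
    vec_index (vec n (\<lambda>i. \<Sum>m\<in>{1..K}. w m * vec_index (A *\<^sub>v (P m *\<^sub>v y)) i)) i"
    using i by simp
qed (use A in simp)

lemma P1_avg:
  assumes K: "1 \<le> K" and y: "y \<in> carrier_vec n" and w: "(\<Sum>m\<in>{1..K}. w m) = 1"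
  shows "P 1 *\<^sub>v avg w y = P 1 *\<^sub>v y"
  using K y w carrier[of 1] 
  by (subst mult_avg) (auto simp: P_P_vec min_def sum_distrib_right[symmetric] intro!: eq_vecI)

lemma D_avg:
  assumes j: "j \<in> {2..K}" and y: "y \<in> carrier_vec n" and w: "(\<Sum>m\<in>{1..K}. w m) = 1"
  shows "D j *\<^sub>v avg w y = (1 - (\<Sum>m\<in>{1..<j}. w m)) \<cdot>\<^sub>v (D j *\<^sub>v y)"
proof -
  have split: "(\<Sum>m\<in>{1..K}. w m) = (\<Sum>m\<in>{1..<j}. w m) + (\<Sum>m\<in>{j..K}. w m)"
    using j by (subst sum.union_disjoint[symmetric]) (auto intro!: sum.cong)
  have *: "(\<Sum>m\<in>{1..K}. w m * vec_index (D j *\<^sub>v (P m *\<^sub>v y)) i) = (1 - (\<Sum>m\<in>{1..<j}. w m)) * vec_index (D j *\<^sub>v y) i"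
    if "i < n" for i
  proof -
    have "(\<Sum>m\<in>{1..K}. w m * vec_index (D j *\<^sub>v (P m *\<^sub>v y)) i)
       = (\<Sum>m\<in>{1..K}. if j \<le> m then w m * vec_index (D j *\<^sub>v y) i else 0)"
      using that j y by (intro sum.cong) (auto simp: D_P_vec)
    also have "\<dots> = (\<Sum>m\<in>{j..K}. w m * vec_index (D j *\<^sub>v y) i)"
      using j by (intro sum.mono_neutral_cong_right) auto
    finally show ?thesis using w split by (simp add: sum_distrib_right[symmetric])
  qed
  show ?thesis
    using D_carrier[OF j] y * by (subst mult_avg) (auto intro!: eq_vecI)
qed

text \<open>
  The deterministic core of the argument: an average with total weight \<open>u\<close> on the models below
  \<open>T\<close> can improve on the projection \<open>P T\<close> only if the noise outweighs the signal in \<open>D T\<close>.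
\<close>

lemma loss_gap:
  assumes T: "2 \<le> T" "T \<le> K"
    and mu: "mu \<in> carrier_vec n" "P T *\<^sub>v mu = mu" and e: "e \<in> carrier_vec n"
    and w: "\<And>m. m \<in> {1..K} \<Longrightarrow> 0 \<le> w m" "(\<Sum>m\<in>{1..K}. w m) = 1"
  defines "u \<equiv> \<Sum>m\<in>{1..<T}. w m"
  shows "ip (P T *\<^sub>v e) (P T *\<^sub>v e)
      + u * (u * ip (D T *\<^sub>v mu) (D T *\<^sub>v mu)
             - 2 * (\<Sum>j = 2..T. \<bar>ip (D j *\<^sub>v mu) e\<bar>)
             - 2 * (\<Sum>j = 2..T. ip (D j *\<^sub>v e) (D j *\<^sub>v e)))
    \<le> ip (mu - avg w (mu + e)) (mu - avg w (mu + e))"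
proof -
  define y where "y = mu + e"
  define r where "r = mu - avg w y"
  define U where "U j = (\<Sum>m\<in>{1..<j}. w m)" for j
  define a where "a j = ip (D j *\<^sub>v mu) (D j *\<^sub>v mu)" for j
  define b where "b j = ip (D j *\<^sub>v mu) e" for j
  define c where "c j = ip (D j *\<^sub>v e) (D j *\<^sub>v e)" for j
  have y: "y \<in> carrier_vec n" and r: "r \<in> carrier_vec n"
    using mu e by (auto simp: y_def r_def)
  have U: "0 \<le> U j" "U j \<le> u" "U j \<le> 1" if "j \<in> {2..T}" for j
  proof -
    show "0 \<le> U j" using that T w by (auto simp: U_def intro!: sum_nonneg)
    show "U j \<le> u" using that T w by (auto simp: U_def u_def intro!: sum_mono2)
    have "U j \<le> (\<Sum>m\<in>{1..K}. w m)" using that T w(1) by (auto simp: U_def intro!: sum_mono2)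
    then show "U j \<le> 1" using w(2) by simp
  qed
  \<comment> \<open>One component: \<open>U j\<close> and \<open>1 - (1 - U j)\<^sup>2\<close> are at most \<open>u\<close> and \<open>2 u\<close>.\<close>
  have comp: "U j * U j * a j - 2 * u * \<bar>b j\<bar> - 2 * u * c j \<le> ip (D j *\<^sub>v r) (D j *\<^sub>v r) - c j"
    if j: "j \<in> {2..T}" for j
  proof -
    have jK: "j \<in> {2..K}" using j T by auto
    note cs = D_vec[OF jK mu(1)] D_vec[OF jK e]
    have "D j *\<^sub>v r = D j *\<^sub>v mu - (1 - U j) \<cdot>\<^sub>v (D j *\<^sub>v y)"
      using mult_minus_distrib_mat_vec[OF D_carrier[OF jK] mu(1) avg_carrier] D_avg[OF jK y w(2)]
      by (simp add: r_def U_def)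
    also have "D j *\<^sub>v y = D j *\<^sub>v mu + D j *\<^sub>v e"
      unfolding y_def by (rule mult_add_distrib_mat_vec[OF D_carrier[OF jK] mu(1) e])
    also have "D j *\<^sub>v mu - (1 - U j) \<cdot>\<^sub>v (D j *\<^sub>v mu + D j *\<^sub>v e)
        = U j \<cdot>\<^sub>v (D j *\<^sub>v mu) - (1 - U j) \<cdot>\<^sub>v (D j *\<^sub>v e)"
      using cs by (intro eq_vecI) (auto simp: algebra_simps carrier_vecD)
    finally have "D j *\<^sub>v r = U j \<cdot>\<^sub>v (D j *\<^sub>v mu) - (1 - U j) \<cdot>\<^sub>v (D j *\<^sub>v e)" .
    moreover have "b j = ip (D j *\<^sub>v mu) (D j *\<^sub>v e)" "b j = ip (D j *\<^sub>v e) (D j *\<^sub>v mu)"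
      using ip_D_D[OF jK e mu(1)] comm_scalar_prod[OF cs] comm_scalar_prod[OF e cs(1)]
      by (auto simp: b_def)
    ultimately have "ip (D j *\<^sub>v r) (D j *\<^sub>v r) = U j * U j * a j - 2 * U j * (1 - U j) * b j + (1 - U j) * (1 - U j) * c j"
      using cs by (simp add: minus_scalar_prod_distrib[where n = n] scalar_prod_minus_distrib[where n = n]
          a_def c_def algebra_simps)
    moreover have "U j * (1 - U j) * b j \<le> u * \<bar>b j\<bar>"
    proof -
      have "U j * (1 - U j) \<le> u * 1" using U[OF j] by (intro mult_mono) auto
      moreover have "0 \<le> U j * (1 - U j)" using U[OF j] by simp
      ultimately show ?thesis
        by (metis abs_ge_self abs_ge_zero mult_left_mono mult_right_mono mult.right_neutral order_trans)
    qed
    moreover have "c j - (1 - U j) * (1 - U j) * c j \<le> 2 * u * c j"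
    proof -
      have "c j - (1 - U j) * (1 - U j) * c j = (2 * U j - U j * U j) * c j" by (simp add: algebra_simps)
      also have "\<dots> \<le> 2 * u * c j"
      proof (rule mult_right_mono)
        show "2 * U j - U j * U j \<le> 2 * u" using U[OF j] zero_le_square[of "U j"] by linarith
      qed (simp add: c_def ip_self_nonneg)
      finally show ?thesis .
    qed
    ultimately show ?thesis by linarith
  qed
  \<comment> \<open>Of the signal terms only the last one is kept.\<close>
  have uu: "u * u * a T \<le> (\<Sum>j = 2..T. U j * U j * a j)"
  proof -
    have "U T * U T * a T \<le> (\<Sum>j = 2..T. U j * U j * a j)"
      using T U by (intro member_le_sum) (auto simp: a_def ip_self_nonneg)
    then show ?thesis by (simp add: U_def u_def)
  qed
  have "u * u * a T - 2 * u * (\<Sum>j = 2..T. \<bar>b j\<bar>) - 2 * u * (\<Sum>j = 2..T. c j)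
      \<le> (\<Sum>j = 2..T. U j * U j * a j - 2 * u * \<bar>b j\<bar> - 2 * u * c j)"
    using uu by (simp add: sum_subtractf sum_distrib_left)
  also have "\<dots> \<le> (\<Sum>j = 2..T. ip (D j *\<^sub>v r) (D j *\<^sub>v r) - c j)"
    by (intro sum_mono comp)
  also have "\<dots> = (ip r (P T *\<^sub>v r) - ip r (P 1 *\<^sub>v r)) - (ip e (P T *\<^sub>v e) - ip e (P 1 *\<^sub>v e))"
    using sum_D[of T r] sum_D[of T e] T r e by (simp add: sum_subtractf c_def)
  \<comment> \<open>The first component does not depend on the weights, as they add up to 1.\<close>
  also have "ip r (P 1 *\<^sub>v r) = ip e (P 1 *\<^sub>v e)"
  proof -
    have one: "1 \<in> {1..K}" using T by auto
    have "P 1 *\<^sub>v r = P 1 *\<^sub>v mu - P 1 *\<^sub>v y"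
      unfolding r_def using mult_minus_distrib_mat_vec[OF carrier[OF one] mu(1) avg_carrier] P1_avg[OF _ y w(2)] one
      by simp
    also have "P 1 *\<^sub>v y = P 1 *\<^sub>v mu + P 1 *\<^sub>v e"
      unfolding y_def by (rule mult_add_distrib_mat_vec[OF carrier[OF one] mu(1) e])
    also have "P 1 *\<^sub>v mu - (P 1 *\<^sub>v mu + P 1 *\<^sub>v e) = (- 1) \<cdot>\<^sub>v (P 1 *\<^sub>v e)"
      using P_vec[OF one mu(1)] P_vec[OF one e] by (intro eq_vecI) auto
    finally have P1r: "P 1 *\<^sub>v r = (- 1) \<cdot>\<^sub>v (P 1 *\<^sub>v e)" .
    have "ip r (P 1 *\<^sub>v r) = ip (P 1 *\<^sub>v r) (P 1 *\<^sub>v r)" using ip_P_P[OF one r r] by simp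
    also have "\<dots> = ip (P 1 *\<^sub>v e) (P 1 *\<^sub>v e)"
      unfolding P1r using P_vec[OF one e] by (simp only: ip_smult_smult)
    finally show ?thesis using ip_P_P[OF one e e] by simp
  qed
  finally have "u * u * a T - 2 * u * (\<Sum>j = 2..T. \<bar>b j\<bar>) - 2 * u * (\<Sum>j = 2..T. c j)
      \<le> ip r (P T *\<^sub>v r) - ip e (P T *\<^sub>v e)" by simp
  moreover have "ip r (P T *\<^sub>v r) \<le> ip r r" using P_contraction[of T r] r T by simp
  moreover have "ip e (P T *\<^sub>v e) = ip (P T *\<^sub>v e) (P T *\<^sub>v e)" using ip_P_P[of T e e] e T by simp
  ultimately have "ip (P T *\<^sub>v e) (P T *\<^sub>v e) + (u * u * a T - 2 * u * (\<Sum>j = 2..T. \<bar>b j\<bar>) - 2 * u * (\<Sum>j = 2..T. c j)) \<le> ip r r"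
    by linarith
  moreover have "u * u * a T - 2 * u * (\<Sum>j = 2..T. \<bar>b j\<bar>) - 2 * u * (\<Sum>j = 2..T. c j)
     = u * (u * a T - 2 * (\<Sum>j = 2..T. \<bar>b j\<bar>) - 2 * (\<Sum>j = 2..T. c j))"
    by (simp only: right_diff_distrib mult.assoc mult.left_commute[of u 2])
  ultimately show ?thesis
    by (simp only: r_def y_def a_def b_def c_def)
qed

end

section \<open>Nested designs and the strength of the signal\<close>

lemma design_carrier [simp]: "design x n p \<in> carrier_mat n p"
  by (simp add: design_def)

lemma design_dim [simp]: "dim_row (design x n p) = n" "dim_col (design x n p) = p"
  by (simp_all add: design_def)

lemma hat_matrix_dim [simp]: "dim_row (hat_matrix X) = dim_row X" "dim_col (hat_matrix X) = dim_row X"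
  by (simp_all add: hat_matrix_def)

lemma design_restrict:
  assumes "p \<le> q"
  shows "design x n p = design x n q * mat q p (\<lambda>(i, j). if i = j then 1 else 0)"
proof (rule eq_matI)
  fix i j assume "i < dim_row (design x n q * mat q p (\<lambda>(i, j). if i = j then 1 else 0))"
    "j < dim_col (design x n q * mat q p (\<lambda>(i, j). if i = j then 1 else 0))"
  then have "i < n" "j < p" by (auto simp: design_def)
  then show "design x n p $$ (i, j) = (design x n q * mat q p (\<lambda>(i, j). if i = j then 1 else 0)) $$ (i, j)"
    using assms by (simp add: design_def scalar_prod_def if_distrib cong: if_cong)
qed (auto simp: design_def)

lemma nested_candidates_chain:
  assumes "nested_candidates x k Mn n"
  shows "projection_chain n Mn (\<lambda>m. hat_matrix (design x n (k m)))"
proof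
  let ?X = "\<lambda>m. design x n (k m)"
  have rank: "vec_space.rank n (?X m) = k m" if "m \<in> {1..Mn}" for m
    using assms that by (simp add: nested_candidates_def)
  fix m
  show "hat_matrix (?X m) \<in> carrier_mat n n" "transpose_mat (hat_matrix (?X m)) = hat_matrix (?X m)"
    if "m \<in> {1..Mn}"
    using hat_matrix_projection[OF design_carrier rank[OF that]] by auto
  fix l assume lm: "1 \<le> l" "l \<le> m" "m \<le> Mn"
  then have l: "l \<in> {1..Mn}" and m: "m \<in> {1..Mn}" by auto
  have "k l \<le> k m"
    using assms l m lm(2) strict_mono_on_leD[of "{1..Mn}" k l m] by (simp add: nested_candidates_def)
  define J where "J = (mat (k m) (k l) (\<lambda>(i, j). if i = j then 1 else 0) :: real mat)"
  have J: "J \<in> carrier_mat (k m) (k l)" by (simp add: J_def)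
  have X: "?X l = ?X m * J" unfolding J_def by (rule design_restrict[OF \<open>k l \<le> k m\<close>])
  obtain C where C: "C \<in> carrier_mat (k l) n" "hat_matrix (?X l) = ?X l * C"
    using hat_matrix_range[OF design_carrier rank[OF l]] by blast
  have H: "hat_matrix (?X m) \<in> carrier_mat n n" by (rule hat_matrix_carrier[OF design_carrier rank[OF m]])
  have "hat_matrix (?X m) * hat_matrix (?X l) = hat_matrix (?X m) * ?X l * C"
    unfolding C(2) by (rule assoc_mult_mat[OF H design_carrier C(1), symmetric])
  also have "hat_matrix (?X m) * ?X l = hat_matrix (?X m) * ?X m * J"
    unfolding X by (rule assoc_mult_mat[OF H design_carrier J, symmetric])
  also have "\<dots> = ?X l" by (simp add: hat_matrix_fixes[OF design_carrier rank[OF m]] X)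
  finally show "hat_matrix (?X m) * hat_matrix (?X l) = hat_matrix (?X l)" by (simp add: C(2))
qed

text \<open>The series defining the mean is a finite sum when the coefficients vanish beyond \<open>q\<close>.\<close>

lemma mean_vec_eq:
  assumes "\<And>j. j > q \<Longrightarrow> \<beta> j = 0"
  shows "mean_vec x \<beta> n = design x n q *\<^sub>v vec q (\<lambda>j. \<beta> (Suc j))"
proof (rule eq_vecI)
  fix i assume "i < dim_vec (design x n q *\<^sub>v vec q (\<lambda>j. \<beta> (Suc j)))"
  then have i: "i < n" by (simp add: design_def)
  have "(\<Sum>j. \<beta> (Suc j) * x (Suc i) (Suc j)) = (\<Sum>j<q. \<beta> (Suc j) * x (Suc i) (Suc j))"
    using assms by (intro suminf_finite) auto
  then show "vec_index (mean_vec x \<beta> n) i = vec_index (design x n q *\<^sub>v vec q (\<lambda>j. \<beta> (Suc j))) i"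
    using i by (simp add: mean_vec_def design_def scalar_prod_def mult.commute atLeast0LessThan)
qed (simp add: mean_vec_def design_def)

lemma mean_vec_carrier [simp]: "mean_vec x \<beta> n \<in> carrier_vec n"
  by (simp add: mean_vec_def)

lemma gram_lower_bound:
  fixes X :: "real mat"
  assumes X: "X \<in> carrier_mat n p" and v: "v \<in> carrier_vec p" and n: "0 < n"
    and kappa: "\<kappa> \<le> lambda_min ((1 / real n) \<cdot>\<^sub>m (transpose_mat X * X))"
  shows "real n * \<kappa> * ip v v \<le> ip (X *\<^sub>v v) (X *\<^sub>v v)"
proof -
  let ?G = "transpose_mat X * X"
  have G: "?G \<in> carrier_mat p p" using X by simp
  have Gs: "transpose_mat ?G = ?G" using X transpose_mult[of "transpose_mat X" p n X p] by simp
  have "\<kappa> * ip v v \<le> lambda_min ((1 / real n) \<cdot>\<^sub>m ?G) * ip v v"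
    using kappa ip_self_nonneg by (rule mult_right_mono)
  also have "\<dots> \<le> ip v (((1 / real n) \<cdot>\<^sub>m ?G) *\<^sub>v v)"
  proof (rule lambda_min_le_quadratic_form[OF _ _ v])
    show "transpose_mat ((1 / real n) \<cdot>\<^sub>m ?G) = (1 / real n) \<cdot>\<^sub>m ?G"
    proof (rule eq_matI)
      fix i j assume "i < dim_row ((1 / real n) \<cdot>\<^sub>m ?G)" "j < dim_col ((1 / real n) \<cdot>\<^sub>m ?G)"
      then have "i < p" "j < p" using G by auto
      then show "transpose_mat ((1 / real n) \<cdot>\<^sub>m ?G) $$ (i, j) = ((1 / real n) \<cdot>\<^sub>m ?G) $$ (i, j)"
        using G arg_cong[OF Gs, of "\<lambda>B. B $$ (i, j)"] by (simp del: index_mult_mat)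
    qed (use G in auto)
  qed (use G in simp)
  also have "((1 / real n) \<cdot>\<^sub>m ?G) *\<^sub>v v = (1 / real n) \<cdot>\<^sub>v (?G *\<^sub>v v)"
    using G v by (intro eq_vecI) auto
  also have "ip v \<dots> = (1 / real n) * ip v (?G *\<^sub>v v)"
    using G v by (intro scalar_prod_smult_distrib) auto
  also have "?G *\<^sub>v v = transpose_mat X *\<^sub>v (X *\<^sub>v v)"
    using X v by (intro assoc_mult_mat_vec[where n\<^sub>1 = p and n\<^sub>2 = n and n\<^sub>3 = p]) auto
  also have "ip v \<dots> = ip (X *\<^sub>v v) (X *\<^sub>v v)"
    using ip_transpose[of "transpose_mat X" p n v "X *\<^sub>v v"] X v by simp
  finally show ?thesis using n by (simp add: field_simps)
qed

text \<open>
  The part of the mean that the model \<open>M0\<close> misses is \<open>X (b - J c)\<close>, where \<open>X\<close> is the design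
  matrix of the true model, \<open>b\<close> the coefficient vector, and \<open>J c\<close> a vector supported on the first
  \<open>k M0\<close> coordinates. On the remaining coordinates \<open>b - J c\<close> agrees with the coefficients.
\<close>

lemma true_signal_lower_bound:
  assumes cand: "nested_candidates x k Mn n" and truth: "true_model \<beta> k M0 Mn" and n: "0 < n"
    and kappa: "0 < \<kappa>" "\<kappa> \<le> lambda_min ((1 / real n) \<cdot>\<^sub>m
       (transpose_mat (design x n (k (M0 + 1))) * design x n (k (M0 + 1))))"
  defines "P \<equiv> \<lambda>m. hat_matrix (design x n (k m))"
  defines "v \<equiv> P (M0 + 1) *\<^sub>v mean_vec x \<beta> n - P M0 *\<^sub>v mean_vec x \<beta> n"
  shows "P (M0 + 1) *\<^sub>v mean_vec x \<beta> n = mean_vec x \<beta> n"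
    and "real n * \<kappa> * eta \<beta> k M0 \<le> ip v v"
proof -
  let ?X = "\<lambda>m. design x n (k m)"
  let ?T = "M0 + 1" and ?mu = "mean_vec x \<beta> n"
  have T: "1 \<le> M0" "M0 \<in> {1..Mn}" "?T \<in> {1..Mn}" using truth by (auto simp: true_model_def)
  have rank: "vec_space.rank n (?X m) = k m" if "m \<in> {1..Mn}" for m
    using cand that by (simp add: nested_candidates_def)
  have kk: "k M0 \<le> k ?T"
    using cand T strict_mono_on_leD[of "{1..Mn}" k M0 ?T] by (simp add: nested_candidates_def)
  define b where "b = vec (k ?T) (\<lambda>j. \<beta> (Suc j))"
  have b: "b \<in> carrier_vec (k ?T)" by (simp add: b_def)
  have mu: "?mu = ?X ?T *\<^sub>v b"
    unfolding b_def using truth by (intro mean_vec_eq) (simp add: true_model_def)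
  have PT: "P ?T \<in> carrier_mat n n"
    unfolding P_def by (rule hat_matrix_carrier[OF design_carrier rank[OF T(3)]])
  show PTmu: "P ?T *\<^sub>v ?mu = ?mu"
    using hat_matrix_fixes[OF design_carrier rank[OF T(3)]] PT b
    unfolding mu P_def by (metis assoc_mult_mat_vec design_carrier)
  obtain C where C: "C \<in> carrier_mat (k M0) n" "P M0 = ?X M0 * C"
    using hat_matrix_range[OF design_carrier rank[OF T(2)]] unfolding P_def by blast
  define J where "J = (mat (k ?T) (k M0) (\<lambda>(i, j). if i = j then 1 else 0) :: real mat)"
  define c where "c = C *\<^sub>v ?mu"
  have J: "J \<in> carrier_mat (k ?T) (k M0)" by (simp add: J_def)
  have c: "c \<in> carrier_vec (k M0)" using C by (simp add: c_def)
  have Jc: "J *\<^sub>v c \<in> carrier_vec (k ?T)" using J c by simp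
  have "P M0 *\<^sub>v ?mu = ?X M0 *\<^sub>v c"
    unfolding C(2) c_def by (rule assoc_mult_mat_vec[OF design_carrier C(1) mean_vec_carrier])
  also have "?X M0 = ?X ?T * J" unfolding J_def by (rule design_restrict[OF kk])
  also have "\<dots> *\<^sub>v c = ?X ?T *\<^sub>v (J *\<^sub>v c)" by (rule assoc_mult_mat_vec[OF design_carrier J c])
  finally have "v = ?X ?T *\<^sub>v (b - J *\<^sub>v c)"
    unfolding v_def PTmu using mult_minus_distrib_mat_vec[OF design_carrier b Jc] mu by simp
  moreover have "real n * \<kappa> * eta \<beta> k M0 \<le> real n * \<kappa> * ip (b - J *\<^sub>v c) (b - J *\<^sub>v c)"
  proof (rule mult_left_mono)
    have tail: "vec_index (b - J *\<^sub>v c) j = \<beta> (Suc j)" if "k M0 \<le> j" "j < k ?T" for j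
    proof -
      have "vec_index (J *\<^sub>v c) j = 0"
        using that c by (auto simp: J_def scalar_prod_def intro!: sum.neutral)
      then show ?thesis using that J by (simp add: b_def)
    qed
    have "true_block k M0 = Suc ` {k M0..<k ?T}"
      by (auto simp: true_block_def image_Suc_atLeastLessThan)
    then have "eta \<beta> k M0 = (\<Sum>j\<in>Suc ` {k M0..<k ?T}. (\<beta> j)\<^sup>2)"
      by (simp only: eta_def)
    also have "\<dots> = (\<Sum>j = k M0..<k ?T. (\<beta> (Suc j))\<^sup>2)"
      by (subst sum.reindex) auto
    also have "\<dots> = (\<Sum>j = k M0..<k ?T. vec_index (b - J *\<^sub>v c) j * vec_index (b - J *\<^sub>v c) j)"
      using tail by (intro sum.cong) (auto simp: power2_eq_square)
    also have "\<dots> \<le> (\<Sum>j = 0..<k ?T. vec_index (b - J *\<^sub>v c) j * vec_index (b - J *\<^sub>v c) j)"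
      by (intro sum_mono2) auto
    finally show "eta \<beta> k M0 \<le> ip (b - J *\<^sub>v c) (b - J *\<^sub>v c)"
      using J by (simp add: scalar_prod_def)
  qed (use kappa n in simp)
  moreover have "b - J *\<^sub>v c \<in> carrier_vec (k ?T)" using b Jc by (rule minus_carrier_vec)
  ultimately show "real n * \<kappa> * eta \<beta> k M0 \<le> ip v v"
    using gram_lower_bound[OF design_carrier _ n kappa(2), of "b - J *\<^sub>v c"] by simp
qed

section \<open>Second moments of the errors\<close>

text \<open>The vector of the first \<open>n\<close> errors.\<close>

abbreviation err :: "(nat \<Rightarrow> 'a \<Rightarrow> real) \<Rightarrow> nat \<Rightarrow> 'a \<Rightarrow> real vec" where
  "err e n \<omega> \<equiv> vec n (\<lambda>i. e (Suc i) \<omega>)"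

context prob_space begin

text \<open>Second moments suffice; square integrability follows from the moment above order 4.\<close>

lemma iid_errorsD:
  assumes "iid_errors M e \<sigma>"
  shows iid_errors_measurable: "1 \<le> i \<Longrightarrow> e i \<in> borel_measurable M"
    and iid_errors_product:
      "1 \<le> i \<Longrightarrow> 1 \<le> j \<Longrightarrow> integrable M (\<lambda>\<omega>. e i \<omega> * e j \<omega>)"
      "1 \<le> i \<Longrightarrow> 1 \<le> j \<Longrightarrow> expectation (\<lambda>\<omega>. e i \<omega> * e j \<omega>) = (if i = j then \<sigma>\<^sup>2 else 0)"
proof -
  have ind: "indep_vars (\<lambda>_. borel) e {1..}" using assms by (simp add: iid_errors_def)
  have meas: "e i \<in> borel_measurable M" if "1 \<le> i" for i
    using ind that by (simp add: indep_vars_def)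
  then show "1 \<le> i \<Longrightarrow> e i \<in> borel_measurable M" .
  obtain \<zeta> where z: "0 < \<zeta>" "\<And>i. 1 \<le> i \<Longrightarrow> integrable M (\<lambda>\<omega>. \<bar>e i \<omega>\<bar> powr (4 + \<zeta>))"
    using assms by (auto simp: iid_errors_def)
  have sq: "integrable M (\<lambda>\<omega>. e i \<omega> * e i \<omega>)" if i: "1 \<le> i" for i
  proof (rule Bochner_Integration.integrable_bound)
    show "integrable M (\<lambda>\<omega>. 1 + \<bar>e i \<omega>\<bar> powr (4 + \<zeta>))" using z(2)[OF i] by simp
    show "(\<lambda>\<omega>. e i \<omega> * e i \<omega>) \<in> borel_measurable M" using meas[OF i] by simp
    have "t * t \<le> 1 + \<bar>t\<bar> powr (4 + \<zeta>)" for t :: real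
    proof (cases "\<bar>t\<bar> \<le> 1")
      case True
      then have "t * t \<le> 1" by (metis abs_square_le_1 power2_eq_square)
      then show ?thesis using powr_ge_zero[of "\<bar>t\<bar>" "4 + \<zeta>"] by linarith
    next
      case False
      have "t * t = \<bar>t\<bar> powr 2" using False by (simp add: powr_numeral power2_eq_square)
      also have "\<dots> \<le> \<bar>t\<bar> powr (4 + \<zeta>)" using False z(1) by (intro powr_mono) auto
      finally show ?thesis by simp
    qed
    then show "AE \<omega> in M. norm (e i \<omega> * e i \<omega>) \<le> norm (1 + \<bar>e i \<omega>\<bar> powr (4 + \<zeta>))"
      by (intro AE_I2) (simp add: abs_mult)
  qed
  have int: "integrable M (e i)" if "1 \<le> i" for i
    using square_integrable_imp_integrable[OF meas[OF that]] sq[OF that] by (simp add: power2_eq_square)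
  assume i: "1 \<le> i" and j: "1 \<le> j"
  have "integrable M (\<lambda>\<omega>. e i \<omega> * e j \<omega>) \<and> expectation (\<lambda>\<omega>. e i \<omega> * e j \<omega>) = (if i = j then \<sigma>\<^sup>2 else 0)"
  proof (cases "i = j")
    case True
    then show ?thesis using sq[OF i] assms i by (simp add: iid_errors_def power2_eq_square)
  next
    case False
    have ij: "indep_vars (\<lambda>_. borel) e {i, j}" by (rule indep_vars_subset[OF ind]) (use i j in auto)
    have "expectation (\<lambda>\<omega>. \<Prod>l\<in>{i, j}. e l \<omega>) = (\<Prod>l\<in>{i, j}. expectation (e l))"
      by (rule indep_vars_lebesgue_integral[OF _ ij]) (use i j int in auto)
    moreover have "integrable M (\<lambda>\<omega>. \<Prod>l\<in>{i, j}. e l \<omega>)"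
      by (rule indep_vars_integrable[OF _ ij]) (use i j int in auto)
    ultimately show ?thesis using False assms i by (simp add: iid_errors_def)
  qed
  then show "integrable M (\<lambda>\<omega>. e i \<omega> * e j \<omega>)"
    "expectation (\<lambda>\<omega>. e i \<omega> * e j \<omega>) = (if i = j then \<sigma>\<^sup>2 else 0)" by auto
qed

lemma expectation_quadratic_form:
  fixes a :: "nat \<Rightarrow> nat \<Rightarrow> real" and n :: nat
  assumes e: "iid_errors M e \<sigma>"
  defines "q \<equiv> \<lambda>\<omega>. \<Sum>i<n. \<Sum>j<n. a i j * (e (Suc i) \<omega> * e (Suc j) \<omega>)"
  shows "integrable M q" and "expectation q = \<sigma>\<^sup>2 * (\<Sum>i<n. a i i)"
proof -
  note p = iid_errors_product[OF e]
  show "integrable M q"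
    unfolding q_def using p(1) by (intro Bochner_Integration.integrable_sum integrable_mult_right) auto
  have "expectation q = (\<Sum>i<n. \<Sum>j<n. expectation (\<lambda>\<omega>. a i j * (e (Suc i) \<omega> * e (Suc j) \<omega>)))"
    unfolding q_def using p(1)
    by (subst Bochner_Integration.integral_sum, simp, subst Bochner_Integration.integral_sum) auto
  also have "\<dots> = (\<Sum>i<n. \<Sum>j<n. if j = i then a i i * \<sigma>\<^sup>2 else 0)"
    using p(2) by (intro sum.cong) auto
  also have "\<dots> = \<sigma>\<^sup>2 * (\<Sum>i<n. a i i)"
    by (simp add: sum_distrib_left mult.commute)
  finally show "expectation q = \<sigma>\<^sup>2 * (\<Sum>i<n. a i i)" .
qed

lemma expectation_matrix_form:
  assumes e: "iid_errors M e \<sigma>" and A: "A \<in> carrier_mat n n"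
  shows "integrable M (\<lambda>\<omega>. ip (err e n \<omega>) (A *\<^sub>v err e n \<omega>))"
    and "expectation (\<lambda>\<omega>. ip (err e n \<omega>) (A *\<^sub>v err e n \<omega>)) = \<sigma>\<^sup>2 * (\<Sum>i<n. A $$ (i, i))"
proof -
  have "ip (err e n \<omega>) (A *\<^sub>v err e n \<omega>) = (\<Sum>i<n. \<Sum>j<n. A $$ (i, j) * (e (Suc i) \<omega> * e (Suc j) \<omega>))" for \<omega>
    using A by (simp add: scalar_prod_def atLeast0LessThan sum_distrib_left mult.left_commute)
  then show "integrable M (\<lambda>\<omega>. ip (err e n \<omega>) (A *\<^sub>v err e n \<omega>))"
    "expectation (\<lambda>\<omega>. ip (err e n \<omega>) (A *\<^sub>v err e n \<omega>)) = \<sigma>\<^sup>2 * (\<Sum>i<n. A $$ (i, i))"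
    using expectation_quadratic_form[OF e, where n = n and a = "\<lambda>i j. A $$ (i, j)"] by simp_all
qed

lemma expectation_linear_form_square:
  assumes e: "iid_errors M e \<sigma>" and v: "v \<in> carrier_vec n"
  shows "integrable M (\<lambda>\<omega>. (ip v (err e n \<omega>))\<^sup>2)"
    and "expectation (\<lambda>\<omega>. (ip v (err e n \<omega>))\<^sup>2) = \<sigma>\<^sup>2 * ip v v"
proof -
  have "(ip v (err e n \<omega>))\<^sup>2 = (\<Sum>i<n. \<Sum>j<n. vec_index v i * vec_index v j * (e (Suc i) \<omega> * e (Suc j) \<omega>))" for \<omega>
    by (simp add: scalar_prod_def atLeast0LessThan power2_eq_square sum_product mult.assoc mult.left_commute)
  moreover have "ip v v = (\<Sum>i<n. vec_index v i * vec_index v i)"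
    using v by (simp add: scalar_prod_def atLeast0LessThan)
  ultimately show "integrable M (\<lambda>\<omega>. (ip v (err e n \<omega>))\<^sup>2)"
    "expectation (\<lambda>\<omega>. (ip v (err e n \<omega>))\<^sup>2) = \<sigma>\<^sup>2 * ip v v"
    using expectation_quadratic_form[OF e, where n = n and a = "\<lambda>i j. vec_index v i * vec_index v j"] by simp_all
qed

end

section \<open>Measurability of the minimal loss\<close>

lemma loss_eq_sum:
  "loss x \<beta> k Mn e n w \<omega> = (\<Sum>i<n. (vec_index (mean_vec x \<beta> n) i - (\<Sum>m\<in>{1..Mn}. w m *
     (\<Sum>j<n. hat_matrix (design x n (k m)) $$ (i, j) * (vec_index (mean_vec x \<beta> n) j + e (Suc j) \<omega>))))\<^sup>2)"
  unfolding loss_def enorm_square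
  by (simp add: averaged_fit_def response_def scalar_prod_def atLeast0LessThan power2_eq_square mean_vec_def)

text \<open>Weights are compared in the product topology on functions.\<close>

lemma continuous_loss: "continuous_on UNIV (\<lambda>w. loss x \<beta> k Mn e n w \<omega>)"
  unfolding loss_eq_sum by (intro continuous_intros continuous_on_product_coordinates)

lemma measurable_loss:
  assumes "\<And>i. 1 \<le> i \<Longrightarrow> e i \<in> borel_measurable M"
  shows "loss x \<beta> k Mn e n w \<in> borel_measurable M"
  unfolding loss_eq_sum[abs_def] using assms by simp

lemma loss_nonneg: "0 \<le> loss x \<beta> k Mn e n w \<omega>"
  by (simp add: loss_def)

lemma Inf_continuous_dense:
  fixes f :: "'b :: topological_space \<Rightarrow> real"
  assumes cont: "continuous_on UNIV f" and D: "D \<subseteq> H" "H \<subseteq> closure D" and H: "H \<noteq> {}"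
    and lower: "\<And>w. c \<le> f w"
  shows "(INF w\<in>H. f w) = (INF w\<in>D. f w)"
proof (rule antisym)
  have bdd: "bdd_below (f ` S)" for S using lower by (auto intro!: bdd_belowI)
  have "D \<noteq> {}" using D H by auto
  then show "(INF w\<in>H. f w) \<le> (INF w\<in>D. f w)" by (intro cINF_superset_mono bdd D) auto
  have "closed {w. (INF w\<in>D. f w) \<le> f w}" using cont by (intro closed_Collect_le) auto
  moreover have "D \<subseteq> {w. (INF w\<in>D. f w) \<le> f w}" by (auto intro!: cINF_lower bdd)
  ultimately have "H \<subseteq> {w. (INF w\<in>D. f w) \<le> f w}" using D(2) closure_minimal by blast
  then show "(INF w\<in>D. f w) \<le> (INF w\<in>H. f w)" using H by (intro cINF_greatest) auto
qed

lemma measurable_INF_loss: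
  assumes "\<And>i. 1 \<le> i \<Longrightarrow> e i \<in> borel_measurable M" and "H \<noteq> {}"
  shows "(\<lambda>\<omega>. INF w\<in>H. loss x \<beta> k Mn e n w \<omega>) \<in> borel_measurable M"
proof -
  obtain D where D: "countable D" "D \<subseteq> H" "H \<subseteq> closure D" using separable[of H] by blast
  have "(\<lambda>\<omega>. INF w\<in>H. loss x \<beta> k Mn e n w \<omega>) = (\<lambda>\<omega>. INF w\<in>D. loss x \<beta> k Mn e n w \<omega>)"
    by (intro ext Inf_continuous_dense[OF continuous_loss D(2,3) assms(2) loss_nonneg])
  then show ?thesis using D(1) measurable_loss[OF assms(1)] by simp
qed

section \<open>The probability that the true model is optimal\<close>

context prob_space begin

lemma loss_true_model:
  assumes cand: "nested_candidates x k Mn n" and truth: "true_model \<beta> k M0 Mn"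
    and proj: "hat_matrix (design x n (k (M0 + 1))) *\<^sub>v mean_vec x \<beta> n = mean_vec x \<beta> n"
  shows "loss x \<beta> k Mn e n (unit_weight Mn (M0 + 1)) \<omega>
    = ip (hat_matrix (design x n (k (M0 + 1))) *\<^sub>v err e n \<omega>) (hat_matrix (design x n (k (M0 + 1))) *\<^sub>v err e n \<omega>)"
proof -
  interpret pc: projection_chain n Mn "\<lambda>m. hat_matrix (design x n (k m))"
    by (rule nested_candidates_chain[OF cand])
  let ?P = "hat_matrix (design x n (k (M0 + 1)))" and ?mu = "mean_vec x \<beta> n"
  have T: "M0 + 1 \<in> {1..Mn}" using truth by (auto simp: true_model_def)
  have err: "err e n \<omega> \<in> carrier_vec n" by simp
  have Pe: "?P *\<^sub>v err e n \<omega> \<in> carrier_vec n" by (rule pc.P_vec[OF T err])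
  have y: "?mu + err e n \<omega> \<in> carrier_vec n" by simp
  have "averaged_fit x k Mn n (unit_weight Mn (M0 + 1)) (?mu + err e n \<omega>) = ?P *\<^sub>v (?mu + err e n \<omega>)"
  proof (rule eq_vecI)
    fix i assume "i < dim_vec (?P *\<^sub>v (?mu + err e n \<omega>))"
    then have i: "i < n" by simp
    have "vec_index (averaged_fit x k Mn n (unit_weight Mn (M0 + 1)) (?mu + err e n \<omega>)) i
       = (\<Sum>m\<in>{1..Mn}. if m = M0 + 1 then vec_index (?P *\<^sub>v (?mu + err e n \<omega>)) i else 0)"
      using i unfolding averaged_fit_def index_vec[OF i] by (intro sum.cong) (auto simp: unit_weight_def)
    then show "vec_index (averaged_fit x k Mn n (unit_weight Mn (M0 + 1)) (?mu + err e n \<omega>)) i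
       = vec_index (?P *\<^sub>v (?mu + err e n \<omega>)) i" using T by simp
  qed (simp add: averaged_fit_def)
  also have "\<dots> = ?mu + ?P *\<^sub>v err e n \<omega>"
    using mult_add_distrib_mat_vec[OF pc.carrier[OF T] mean_vec_carrier err] proj by simp
  finally have "?mu - averaged_fit x k Mn n (unit_weight Mn (M0 + 1)) (response x \<beta> e n \<omega>)
      = (- 1) \<cdot>\<^sub>v (?P *\<^sub>v err e n \<omega>)"
    using Pe unfolding response_def by (intro eq_vecI) (auto simp: carrier_vecD mean_vec_def)
  then show ?thesis unfolding loss_def enorm_square using ip_smult_smult[OF Pe Pe, of "-1" "-1"] by simp
qed

text \<open>
  The quantitative form of the result at a single sample size. The true model is optimal when the
  noise terms \<open>c\<close> and \<open>q\<close> of the proof stay below \<open>t/4\<close> and \<open>(t/4)\<^sup>2\<close>; the two error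
  terms are Markov bounds for the complementary events.
\<close>

proposition prob_true_model_optimal:
  assumes e: "iid_errors M e \<sigma>" and cand: "nested_candidates x k Mn n"
    and truth: "true_model \<beta> k M0 Mn" and n: "0 < n"
    and kappa: "0 < \<kappa>" "\<kappa> \<le> lambda_min ((1 / real n) \<cdot>\<^sub>m
       (transpose_mat (design x n (k (M0 + 1))) * design x n (k (M0 + 1))))"
    and H: "H \<subseteq> weights Mn" "unit_weight Mn (M0 + 1) \<in> H"
    and gap: "\<And>w. w \<in> H \<Longrightarrow> (\<Sum>m\<in>{1..<M0+1}. w m) = 0 \<or> u0 \<le> (\<Sum>m\<in>{1..<M0+1}. w m)" "0 < u0"
  defines "t \<equiv> u0 * (real n * \<kappa> * eta \<beta> k M0)"
  shows "1 - (4 * \<sigma>\<^sup>2 * (real (k (M0 + 1)) - real (k 1)) / t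
      + 16 * \<sigma>\<^sup>2 * (real M0 * (enorm (mean_vec x \<beta> n))\<^sup>2) / t\<^sup>2)
    \<le> \<P>(\<omega> in M. (INF w\<in>H. loss x \<beta> k Mn e n w \<omega>) = loss x \<beta> k Mn e n (unit_weight Mn (M0 + 1)) \<omega>)"
proof -
  define P where "P = (\<lambda>m. hat_matrix (design x n (k m)))"
  interpret pc: projection_chain n Mn P
    unfolding P_def by (rule nested_candidates_chain[OF cand])
  let ?T = "M0 + 1" and ?mu = "mean_vec x \<beta> n" and ?wT = "unit_weight Mn (M0 + 1)"
  let ?L = "loss x \<beta> k Mn e n"
  have T: "2 \<le> ?T" "?T \<le> Mn" "?T \<in> {1..Mn}" "1 \<in> {1..Mn}" "1 \<le> ?T" "?T \<in> {2..Mn}"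
    using truth by (auto simp: true_model_def)
  have mu: "?mu \<in> carrier_vec n" by simp
  have Pmu: "P ?T *\<^sub>v ?mu = ?mu"
    unfolding P_def by (rule true_signal_lower_bound(1)[OF cand truth n kappa])
  have signal: "real n * \<kappa> * eta \<beta> k M0 \<le> ip (pc.D ?T *\<^sub>v ?mu) (pc.D ?T *\<^sub>v ?mu)"
    using true_signal_lower_bound(2)[OF cand truth n kappa] pc.D_mult_vec[OF T(6) mu] by (simp add: P_def)
  have "0 < eta \<beta> k M0"
    using truth unfolding eta_def true_model_def by (auto intro!: sum_pos2 simp: true_block_def)
  then have t: "0 < t" using n kappa(1) gap(2) by (simp add: t_def)
  define c where "c \<omega> = (\<Sum>j = 2..?T. ip (pc.D j *\<^sub>v err e n \<omega>) (pc.D j *\<^sub>v err e n \<omega>))" for \<omega>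
  define q where "q \<omega> = real M0 * (\<Sum>j = 2..?T. (ip (pc.D j *\<^sub>v ?mu) (err e n \<omega>))\<^sup>2)" for \<omega>

  have c_eq: "c \<omega> = ip (err e n \<omega>) (P ?T *\<^sub>v err e n \<omega>) - ip (err e n \<omega>) (P 1 *\<^sub>v err e n \<omega>)" for \<omega>
    unfolding c_def by (rule pc.sum_D[OF T(5) T(2)]) simp
  have trace: "(\<Sum>i<n. P m $$ (i, i)) = real (k m)" if "m \<in> {1..Mn}" for m
    unfolding P_def using cand that
    by (intro hat_matrix_trace[OF design_carrier]) (simp add: nested_candidates_def)
  note form = expectation_matrix_form[OF e pc.carrier]
  have c_int: "integrable M c"
    unfolding c_eq[abs_def] using form(1)[OF T(3)] form(1)[OF T(4)] by simp
  have c_exp: "expectation c = \<sigma>\<^sup>2 * (real (k ?T) - real (k 1))"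
    unfolding c_eq[abs_def] using form[OF T(3)] form[OF T(4)] trace[OF T(3)] trace[OF T(4)]
    by (simp add: algebra_simps)
  have c_nonneg: "0 \<le> c \<omega>" for \<omega> by (simp add: c_def sum_nonneg ip_self_nonneg)

  have lin: "integrable M (\<lambda>\<omega>. (ip (pc.D j *\<^sub>v ?mu) (err e n \<omega>))\<^sup>2)"
    "expectation (\<lambda>\<omega>. (ip (pc.D j *\<^sub>v ?mu) (err e n \<omega>))\<^sup>2) = \<sigma>\<^sup>2 * ip (pc.D j *\<^sub>v ?mu) (pc.D j *\<^sub>v ?mu)"
    if "j \<in> {2..?T}" for j
    using expectation_linear_form_square[OF e pc.D_vec[OF _ mu], of j] that T by auto
  have q_int: "integrable M q"
    unfolding q_def[abs_def] using lin(1) by (intro integrable_mult_right Bochner_Integration.integrable_sum)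
  have "expectation q = real M0 * (\<Sum>j = 2..?T. \<sigma>\<^sup>2 * ip (pc.D j *\<^sub>v ?mu) (pc.D j *\<^sub>v ?mu))"
    unfolding q_def[abs_def] using lin
    by (subst integral_mult_right_zero, subst Bochner_Integration.integral_sum) (auto intro!: sum.cong)
  also have "\<dots> = real M0 * (\<sigma>\<^sup>2 * (ip ?mu (P ?T *\<^sub>v ?mu) - ip ?mu (P 1 *\<^sub>v ?mu)))"
    using pc.sum_D[OF T(5) T(2) mu] by (simp add: sum_distrib_left[symmetric])
  also have "\<dots> \<le> real M0 * (\<sigma>\<^sup>2 * ip ?mu ?mu)"
    using pc.ip_P_P[OF T(4) mu mu] ip_self_nonneg[of "P 1 *\<^sub>v ?mu"] Pmu by (intro mult_left_mono) auto
  finally have q_exp: "expectation q \<le> \<sigma>\<^sup>2 * (real M0 * (enorm ?mu)\<^sup>2)"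
    by (simp add: enorm_square algebra_simps)
  have q_nonneg: "0 \<le> q \<omega>" for \<omega> by (simp add: q_def sum_nonneg)

  define s where "s = t / 4"
  have s: "0 < s" using t by (simp add: s_def)
  \<comment> \<open>The set \<open>A\<close> in Markov's inequality does not occur in its conclusion.\<close>
  have "prob {\<omega> \<in> space M. s \<le> c \<omega>} \<le> expectation c / s"
    using c_int c_nonneg s by (intro integral_Markov_inequality_measure[where A = "{}"]) auto
  also have "\<dots> = 4 * \<sigma>\<^sup>2 * (real (k ?T) - real (k 1)) / t"
    unfolding c_exp s_def by simp
  finally have bad_c: "prob {\<omega> \<in> space M. s \<le> c \<omega>} \<le> 4 * \<sigma>\<^sup>2 * (real (k ?T) - real (k 1)) / t" .
  have "prob {\<omega> \<in> space M. s\<^sup>2 \<le> q \<omega>} \<le> expectation q / s\<^sup>2"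
    using q_int q_nonneg s by (intro integral_Markov_inequality_measure[where A = "{}"]) auto
  also have "\<dots> \<le> \<sigma>\<^sup>2 * (real M0 * (enorm ?mu)\<^sup>2) / s\<^sup>2"
    using q_exp by (intro divide_right_mono) auto
  also have "\<dots> = 16 * \<sigma>\<^sup>2 * (real M0 * (enorm ?mu)\<^sup>2) / t\<^sup>2"
    unfolding s_def by (simp add: power_divide)
  finally have bad_q: "prob {\<omega> \<in> space M. s\<^sup>2 \<le> q \<omega>} \<le> 16 * \<sigma>\<^sup>2 * (real M0 * (enorm ?mu)\<^sup>2) / t\<^sup>2" .

  define E where "E = {\<omega> \<in> space M. (INF w\<in>H. ?L w \<omega>) = ?L ?wT \<omega>}"
  note meas = iid_errors_measurable[OF e]
  have Ho: "H \<noteq> {}" using H(2) by auto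
  have E: "E \<in> events"
    unfolding E_def using measurable_INF_loss[OF meas Ho] measurable_loss[OF meas] by simp
  have good: "\<omega> \<in> E" if om: "\<omega> \<in> space M" "c \<omega> < s" "q \<omega> < s\<^sup>2" for \<omega>
  proof -
    define B where "B = (\<Sum>j = 2..?T. \<bar>ip (pc.D j *\<^sub>v ?mu) (err e n \<omega>)\<bar>)"
    have "B\<^sup>2 \<le> q \<omega>"
      using Cauchy_Schwarz_ineq_sum[of "\<lambda>_. 1" "\<lambda>j. \<bar>ip (pc.D j *\<^sub>v ?mu) (err e n \<omega>)\<bar>" "{2..?T}"]
      by (simp add: B_def q_def)
    then have B: "B < s" using om(3) s by (intro power2_less_imp_less[of B s]) auto
    have "?L ?wT \<omega> \<le> ?L w \<omega>" if w: "w \<in> H" for w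
    proof -
      define u where "u = (\<Sum>m\<in>{1..<?T}. w m)"
      have wp: "0 \<le> w m" if "m \<in> {1..Mn}" for m
        using H(1) w that by (fastforce simp: weights_def dest: PiE_mem)
      have w1: "(\<Sum>m\<in>{1..Mn}. w m) = 1" using H(1) w by (auto simp: weights_def)
      have err: "err e n \<omega> \<in> carrier_vec n" by simp
      have "?L w \<omega> = ip (?mu - pc.avg w (?mu + err e n \<omega>)) (?mu - pc.avg w (?mu + err e n \<omega>))"
        unfolding loss_def enorm_square averaged_fit_def response_def pc.avg_def unfolding P_def ..
      moreover have "?L ?wT \<omega> = ip (P ?T *\<^sub>v err e n \<omega>) (P ?T *\<^sub>v err e n \<omega>)"
        using loss_true_model[OF cand truth] Pmu by (simp add: P_def)
      ultimately have gapineq: "?L ?wT \<omega> + u * (u * ip (pc.D ?T *\<^sub>v ?mu) (pc.D ?T *\<^sub>v ?mu) - 2 * B - 2 * c \<omega>) \<le> ?L w \<omega>"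
        using pc.loss_gap[OF T(1,2) mu Pmu err wp w1] by (simp add: u_def B_def c_def)
      have "0 \<le> u * (u * ip (pc.D ?T *\<^sub>v ?mu) (pc.D ?T *\<^sub>v ?mu) - 2 * B - 2 * c \<omega>)"
      proof (cases "u = 0")
        case False
        then have u: "u0 \<le> u" using gap(1)[OF w] by (auto simp: u_def)
        have "4 * s \<le> u * ip (pc.D ?T *\<^sub>v ?mu) (pc.D ?T *\<^sub>v ?mu)"
          using mult_mono[OF u signal] u gap(2) n kappa(1) \<open>0 < eta \<beta> k M0\<close> by (simp add: s_def t_def)
        then show ?thesis using om(2) B u gap(2) s by (intro mult_nonneg_nonneg) auto
      qed simp
      then show ?thesis using gapineq by linarith
    qed
    then have "(INF w\<in>H. ?L w \<omega>) = ?L ?wT \<omega>"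
      using H(2) loss_nonneg by (intro antisym cINF_lower cINF_greatest) (auto intro!: bdd_belowI)
    then show ?thesis using om(1) by (simp add: E_def)
  qed
  have [measurable]: "c \<in> borel_measurable M" "q \<in> borel_measurable M"
    using c_int q_int by auto
  have "prob (space M - E) \<le> prob ({\<omega> \<in> space M. s \<le> c \<omega>} \<union> {\<omega> \<in> space M. s\<^sup>2 \<le> q \<omega>})"
    using good by (intro finite_measure_mono) (auto simp: not_le[symmetric])
  also have "\<dots> \<le> prob {\<omega> \<in> space M. s \<le> c \<omega>} + prob {\<omega> \<in> space M. s\<^sup>2 \<le> q \<omega>}"
    by (intro measure_Un_le) auto
  finally have "1 - prob E \<le> prob {\<omega> \<in> space M. s \<le> c \<omega>} + prob {\<omega> \<in> space M. s\<^sup>2 \<le> q \<omega>}"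
    using prob_compl[OF E] by simp
  then show ?thesis using bad_c bad_q by (simp add: E_def)
qed

end

section \<open>The weight sets\<close>

lemma unit_weight_in_weights: "m \<in> {1..Mn} \<Longrightarrow> unit_weight Mn m \<in> weights Mn"
  by (auto simp: weights_def unit_weight_def)

lemma discrete_weights_subset: "discrete_weights N Mn \<subseteq> weights Mn"
  by (fastforce simp: discrete_weights_def weights_def PiE_iff divide_le_eq_1)

lemma unit_weight_in_discrete_weights:
  assumes "1 \<le> N" "m \<in> {1..Mn}"
  shows "unit_weight Mn m \<in> discrete_weights N Mn"
proof -
  have "(0::real) = real 0 / real N" "(1::real) = real N / real N" using assms by auto
  then have "0 \<in> {real l / real N | l. l \<le> N}" "1 \<in> {real l / real N | l. l \<le> N}" by blast+
  then show ?thesis using assms by (auto simp: discrete_weights_def unit_weight_def)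
qed

text \<open>A sum of natural multiples of \<open>1/N\<close> that is not 0 is at least \<open>1/N\<close>.\<close>

lemma discrete_weights_gap:
  assumes w: "w \<in> discrete_weights N Mn" and A: "A \<subseteq> {1..Mn}"
  shows "sum w A = 0 \<or> 1 / real N \<le> sum w A"
proof -
  have "\<forall>m\<in>{1..Mn}. \<exists>l. w m = real l / real N" using w by (fastforce simp: discrete_weights_def PiE_iff)
  then obtain l where l: "\<And>m. m \<in> {1..Mn} \<Longrightarrow> w m = real (l m) / real N" by metis
  have "sum w A = (\<Sum>m\<in>A. real (l m) / real N)" using A l by (intro sum.cong) auto
  also have "\<dots> = real (sum l A) / real N" by (simp add: sum_divide_distrib)
  finally have *: "sum w A = real (sum l A) / real N" .
  show ?thesis
  proof (cases "sum l A = 0")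
    case False
    then have "1 \<le> real (sum l A)" by linarith
    then show ?thesis unfolding * by (intro disjI2 divide_right_mono) auto
  qed (simp add: *)
qed

lemma unit_weight_in_delta_weights:
  assumes "M0 + 1 \<in> {1..Mn}"
  shows "unit_weight Mn (M0 + 1) \<in> delta_weights \<delta> \<tau> M0 Mn n"
  using unit_weight_in_weights[OF assms] assms
  by (auto simp: delta_weights_def unit_weight_def intro!: sum.neutral)

lemma le_strict_mono_dim:
  assumes "nested_candidates x k Mn n"
  shows "m \<in> {1..Mn} \<Longrightarrow> m \<le> k m"
proof (induction m)
  case (Suc m)
  show ?case
  proof (cases "m = 0")
    case True
    then show ?thesis using assms by (simp add: nested_candidates_def)
  next
    case False
    then have "m \<le> k m" "k m < k (Suc m)"
      using Suc assms by (auto simp: nested_candidates_def intro: strict_mono_onD)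
    then show ?thesis by simp
  qed
qed simp

section \<open>Limits\<close>

lemma borel_measurable_loss_ratio [measurable (raw)]:
  assumes [measurable]: "f \<in> borel_measurable M" "g \<in> borel_measurable M"
  shows "(\<lambda>\<omega>. loss_ratio (f \<omega>) (g \<omega>)) \<in> borel_measurable M"
  unfolding loss_ratio_def by measurable

lemma nested_true_dims:
  assumes "nested_candidates x k Mn n" and "true_model \<beta> k M0 Mn"
  shows "0 \<le> real (k (M0 + 1)) - real (k 1)" "M0 \<le> k (M0 + 1)" "0 < eta \<beta> k M0"
proof -
  have T: "1 \<in> {1..Mn}" "M0 + 1 \<in> {1..Mn}" using assms(2) by (auto simp: true_model_def)
  show "0 \<le> real (k (M0 + 1)) - real (k 1)"
    using assms(1) T strict_mono_on_leD[of "{1..Mn}" k 1 "M0 + 1"] by (simp add: nested_candidates_def)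
  show "M0 \<le> k (M0 + 1)" using le_strict_mono_dim[OF assms(1) T(2)] by simp
  show "0 < eta \<beta> k M0"
    using assms(2) unfolding eta_def true_model_def by (auto intro!: sum_pos2 simp: true_block_def)
qed

text \<open>
  All parts of the theorem are instances of this limit, in which \<open>u n > 0\<close> is a lower bound for the
  nonzero total weights that elements of \<open>H n\<close> put on the models below the true one.
\<close>

lemma (in prob_space) tendsto_prob_true_model_optimal:
  fixes e :: "nat \<Rightarrow> 'a \<Rightarrow> real"
    and x :: "nat \<Rightarrow> nat \<Rightarrow> nat \<Rightarrow> real" and \<beta> :: "nat \<Rightarrow> nat \<Rightarrow> real"
    and k :: "nat \<Rightarrow> nat \<Rightarrow> nat" and Mn M0 :: "nat \<Rightarrow> nat" and n0 :: nat
  defines "\<eta> \<equiv> \<lambda>n. eta (\<beta> n) (k n) (M0 n)"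
    and "L \<equiv> \<lambda>n. loss (x n) (\<beta> n) (k n) (Mn n) e n"
    and "wT \<equiv> \<lambda>n. unit_weight (Mn n) (M0 n + 1)"
  assumes errors: "iid_errors M e \<sigma>"
    and models: "\<forall>n\<ge>n0. nested_candidates (x n) (k n) (Mn n) n"
    and truth: "\<forall>n\<ge>n0. true_model (\<beta> n) (k n) (M0 n) (Mn n)"
    and C1: "(\<lambda>n. (enorm (mean_vec (x n) (\<beta> n) n))\<^sup>2 / real n) \<in> O(\<lambda>_. 1)"
    and C2: "0 < \<kappa>0" "\<forall>n\<ge>n0. lambda_min ((1 / real n) \<cdot>\<^sub>m
       (transpose_mat (design (x n) n (k n (M0 n + 1))) * design (x n) n (k n (M0 n + 1)))) \<ge> \<kappa>0"
    and H: "\<And>n. n0 \<le> n \<Longrightarrow> H n \<subseteq> weights (Mn n)" "\<And>n. n0 \<le> n \<Longrightarrow> wT n \<in> H n"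
    and gap: "\<And>n w. n0 \<le> n \<Longrightarrow> w \<in> H n \<Longrightarrow>
        (\<Sum>m\<in>{1..<M0 n + 1}. w m) = 0 \<or> u n \<le> (\<Sum>m\<in>{1..<M0 n + 1}. w m)"
      "\<And>n. n0 \<le> n \<Longrightarrow> 0 < n \<Longrightarrow> 0 < u n"
    and dims: "(\<lambda>n. (real (k n (M0 n + 1)) - real (k n 1)) / (real n * \<eta> n * u n)) \<longlonglongrightarrow> 0"
    and count: "(\<lambda>n. real (M0 n) / (real n * (\<eta> n)\<^sup>2 * (u n)\<^sup>2)) \<longlonglongrightarrow> 0"
  shows "(\<lambda>n. \<P>(\<omega> in M. (INF w\<in>H n. L n w \<omega>) = L n (wT n) \<omega>)) \<longlonglongrightarrow> 1"
proof -
  define d where "d n = (real (k n (M0 n + 1)) - real (k n 1)) / (real n * \<eta> n * u n)" for n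
  define c where "c n = real (M0 n) / (real n * (\<eta> n)\<^sup>2 * (u n)\<^sup>2)" for n
  obtain C where C: "\<forall>\<^sub>F n in sequentially. norm ((enorm (mean_vec (x n) (\<beta> n) n))\<^sup>2 / real n) \<le> C * norm (1::real)"
    using C1 by (elim landau_o.bigE)
  define lower where "lower n = 1 - (4 * \<sigma>\<^sup>2 / \<kappa>0 * d n + 16 * \<sigma>\<^sup>2 / \<kappa>0\<^sup>2 * (C * c n))" for n
  have "lower \<longlonglongrightarrow> 1 - (4 * \<sigma>\<^sup>2 / \<kappa>0 * 0 + 16 * \<sigma>\<^sup>2 / \<kappa>0\<^sup>2 * (C * 0))"
    unfolding lower_def[abs_def] using dims count unfolding d_def[abs_def] c_def[abs_def]
    by (intro tendsto_intros)
  then have lower: "lower \<longlonglongrightarrow> 1" by simp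
  have "\<forall>\<^sub>F n in sequentially. lower n \<le> \<P>(\<omega> in M. (INF w\<in>H n. L n w \<omega>) = L n (wT n) \<omega>)"
    using C eventually_ge_at_top[of n0] eventually_gt_at_top[of 0]
  proof eventually_elim
    case (elim n)
    have at_n: "nested_candidates (x n) (k n) (Mn n) n" "true_model (\<beta> n) (k n) (M0 n) (Mn n)"
      "\<kappa>0 \<le> lambda_min ((1 / real n) \<cdot>\<^sub>m
         (transpose_mat (design (x n) n (k n (M0 n + 1))) * design (x n) n (k n (M0 n + 1))))"
      using models truth C2(2) elim(2) by auto
    let ?t = "u n * (real n * \<kappa>0 * \<eta> n)" and ?mu2 = "(enorm (mean_vec (x n) (\<beta> n) n))\<^sup>2"
    have "0 \<le> c n" by (simp add: c_def)
    have "4 * \<sigma>\<^sup>2 * (real (k n (M0 n + 1)) - real (k n 1)) / ?t = 4 * \<sigma>\<^sup>2 / \<kappa>0 * d n"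
      by (simp add: d_def mult_ac)
    moreover have "16 * \<sigma>\<^sup>2 * (real (M0 n) * ?mu2) / ?t\<^sup>2 = 16 * \<sigma>\<^sup>2 / \<kappa>0\<^sup>2 * (?mu2 / real n * c n)"
      using elim(3) by (simp add: c_def power2_eq_square field_simps)
    moreover have "16 * \<sigma>\<^sup>2 / \<kappa>0\<^sup>2 * (?mu2 / real n * c n) \<le> 16 * \<sigma>\<^sup>2 / \<kappa>0\<^sup>2 * (C * c n)"
      using elim(1) \<open>0 \<le> c n\<close> by (intro mult_left_mono mult_right_mono) auto
    ultimately have "lower n \<le> 1 - (4 * \<sigma>\<^sup>2 * (real (k n (M0 n + 1)) - real (k n 1)) / ?t
        + 16 * \<sigma>\<^sup>2 * (real (M0 n) * ?mu2) / ?t\<^sup>2)"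
      unfolding lower_def by linarith
    also have "\<dots> \<le> \<P>(\<omega> in M. (INF w\<in>H n. L n w \<omega>) = L n (wT n) \<omega>)"
      unfolding L_def wT_def \<eta>_def
      using prob_true_model_optimal[OF errors at_n(1,2) elim(3) C2(1) at_n(3)
          H(1)[OF elim(2)] H(2)[OF elim(2), unfolded wT_def] gap(1)[OF elim(2)] gap(2)[OF elim(2,3)]] .
    finally show ?case .
  qed
  then show ?thesis
    by (rule tendsto_sandwich[OF _ _ lower tendsto_const]) simp
qed

text \<open>Where the losses agree, their ratio is exactly 1, the case \<open>0/0\<close> included.\<close>

lemma (in prob_space) tendsto_in_prob_loss_ratio:
  assumes prob: "(\<lambda>n. \<P>(\<omega> in M. g n \<omega> = f n \<omega>)) \<longlonglongrightarrow> 1"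
    and f: "\<forall>\<^sub>F n in sequentially. f n \<in> borel_measurable M"
    and g: "\<forall>\<^sub>F n in sequentially. g n \<in> borel_measurable M"
  shows "tendsto_in_prob M (\<lambda>n \<omega>. loss_ratio (f n \<omega>) (g n \<omega>)) 1"
  unfolding tendsto_in_prob_def
proof (intro conjI allI impI)
  show "\<forall>\<^sub>F n in sequentially. (\<lambda>\<omega>. loss_ratio (f n \<omega>) (g n \<omega>)) \<in> borel_measurable M"
    using f g by eventually_elim simp
  fix \<epsilon> :: real assume "0 < \<epsilon>"
  have upper: "(\<lambda>n. 1 - \<P>(\<omega> in M. g n \<omega> = f n \<omega>)) \<longlonglongrightarrow> 0"
    using tendsto_diff[OF tendsto_const prob, of 1] by simp
  have "\<forall>\<^sub>F n in sequentially. \<P>(\<omega> in M. \<epsilon> < \<bar>loss_ratio (f n \<omega>) (g n \<omega>) - 1\<bar>) \<le> 1 - \<P>(\<omega> in M. g n \<omega> = f n \<omega>)"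
    using f g
  proof eventually_elim
    case (elim n)
    note [measurable] = elim
    have "\<P>(\<omega> in M. \<epsilon> < \<bar>loss_ratio (f n \<omega>) (g n \<omega>) - 1\<bar>) \<le> prob (space M - {\<omega> \<in> space M. g n \<omega> = f n \<omega>})"
      using \<open>0 < \<epsilon>\<close> by (intro finite_measure_mono) (auto simp: loss_ratio_def)
    also have "\<dots> = 1 - \<P>(\<omega> in M. g n \<omega> = f n \<omega>)" by (rule prob_compl) simp
    finally show ?case .
  qed
  then show "(\<lambda>n. \<P>(\<omega> in M. \<epsilon> < \<bar>loss_ratio (f n \<omega>) (g n \<omega>) - 1\<bar>)) \<longlonglongrightarrow> 0"
    by (rule tendsto_sandwich[OF _ _ tendsto_const upper, rotated]) simp
qed

theorem mainTheorem3:
  fixes M :: "'a measure" and e :: "nat \<Rightarrow> 'a \<Rightarrow> real" and \<sigma> :: real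
    and x :: "nat \<Rightarrow> nat \<Rightarrow> nat \<Rightarrow> real" and \<beta> :: "nat \<Rightarrow> nat \<Rightarrow> real"
    and k :: "nat \<Rightarrow> nat \<Rightarrow> nat" and Mn M0 :: "nat \<Rightarrow> nat" and n0 N :: nat and \<delta> \<tau>0 :: real
  defines "\<eta> \<equiv> \<lambda>n. eta (\<beta> n) (k n) (M0 n)"
    and "L \<equiv> \<lambda>n. loss (x n) (\<beta> n) (k n) (Mn n) e n"
    and "wT \<equiv> \<lambda>n. unit_weight (Mn n) (M0 n + 1)"
    and "HN \<equiv> \<lambda>n. discrete_weights N (Mn n)"
    and "H\<delta> \<equiv> \<lambda>n. delta_weights \<delta> \<tau>0 (M0 n) (Mn n) n"
  assumes prob: "prob_space M"
    and errors: "iid_errors M e \<sigma>"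
    and models: "\<forall>n\<ge>n0. nested_candidates (x n) (k n) (Mn n) n"
    and truth: "\<forall>n\<ge>n0. true_model (\<beta> n) (k n) (M0 n) (Mn n)"
    and N: "N \<ge> 1" and \<delta>: "\<delta> > 0" and \<tau>0: "\<tau>0 > 0"
    and C1: "(\<lambda>n. (enorm (mean_vec (x n) (\<beta> n) n))\<^sup>2 / real n) \<in> O(\<lambda>_. 1)"
    and C2: "\<exists>\<kappa>0>0. \<forall>n\<ge>n0.
               lambda_min ((1 / real n) \<cdot>\<^sub>m
                 (transpose_mat (design (x n) n (k n (M0 n + 1))) * design (x n) n (k n (M0 n + 1))))
               \<ge> \<kappa>0"
  shows
    "((\<lambda>n. (real (k n (M0 n + 1)) - real (k n 1)) / (real n * \<eta> n)) \<longlonglongrightarrow> 0 \<longrightarrow>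
      (\<lambda>n. real (M0 n) / (real n * (\<eta> n)\<^sup>2)) \<longlonglongrightarrow> 0 \<longrightarrow>
      (\<lambda>n. \<P>(\<omega> in M. (INF w\<in>HN n. L n w \<omega>) = L n (wT n) \<omega>)) \<longlonglongrightarrow> 1)
     \<and>
     ((\<exists>c>0. \<forall>n\<ge>n0. \<eta> n \<ge> c * real n powr (- \<tau>0)) \<longrightarrow>
      (\<lambda>n. (real (k n (M0 n + 1)) - real (k n 1)) / real n powr (1 - 2 * \<tau>0)) \<longlonglongrightarrow> 0 \<longrightarrow>
      (\<lambda>n. real (M0 n) / real n powr (1 - 4 * \<tau>0)) \<longlonglongrightarrow> 0 \<longrightarrow>
      (\<lambda>n. \<P>(\<omega> in M. (INF w\<in>H\<delta> n. L n w \<omega>) = L n (wT n) \<omega>)) \<longlonglongrightarrow> 1)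
     \<and>
     ((\<exists>K. \<forall>n\<ge>n0. k n (M0 n + 1) = K) \<longrightarrow> (\<lambda>n. inverse (\<eta> n)) \<in> O(\<lambda>_. 1) \<longrightarrow>
      tendsto_in_prob M (\<lambda>n \<omega>. loss_ratio (L n (wT n) \<omega>) (INF w\<in>HN n. L n w \<omega>)) 1
      \<and>
      (\<tau>0 < 1 / 2 \<longrightarrow>
       tendsto_in_prob M (\<lambda>n \<omega>. loss_ratio (L n (wT n) \<omega>) (INF w\<in>H\<delta> n. L n w \<omega>)) 1))"
proof -
  interpret prob_space M by (rule prob)
  obtain \<kappa>0 where \<kappa>0: "0 < \<kappa>0" "\<forall>n\<ge>n0. lambda_min ((1 / real n) \<cdot>\<^sub>m
       (transpose_mat (design (x n) n (k n (M0 n + 1))) * design (x n) n (k n (M0 n + 1)))) \<ge> \<kappa>0"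
    using C2 by blast
  have models': "\<And>n. n0 \<le> n \<Longrightarrow> nested_candidates (x n) (k n) (Mn n) n"
    and truth': "\<And>n. n0 \<le> n \<Longrightarrow> true_model (\<beta> n) (k n) (M0 n) (Mn n)"
    using models truth by auto
  have T: "M0 n + 1 \<in> {1..Mn n}" if "n0 \<le> n" for n
    using truth'[OF that] by (auto simp: true_model_def)
  have folds: "eta (\<beta> n) (k n) (M0 n) = \<eta> n" "loss (x n) (\<beta> n) (k n) (Mn n) e n = L n"
    "unit_weight (Mn n) (M0 n + 1) = wT n" for n
    by (simp_all add: \<eta>_def L_def wT_def)
  note dims_facts = nested_true_dims[OF models' truth', unfolded folds]
  define d where "d n = real (k n (M0 n + 1)) - real (k n 1)" for n
  define u\<delta> where "u\<delta> n = \<delta> * real n powr (- \<tau>0)" for n :: nat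
  have HN: "HN n \<subseteq> weights (Mn n)" "wT n \<in> HN n" if "n0 \<le> n" for n
    using discrete_weights_subset unit_weight_in_discrete_weights[OF N T[OF that]] by (auto simp: HN_def wT_def)
  have H\<delta>: "H\<delta> n \<subseteq> weights (Mn n)" "wT n \<in> H\<delta> n" if "n0 \<le> n" for n
    using unit_weight_in_delta_weights[OF T[OF that]] by (auto simp: H\<delta>_def wT_def delta_weights_def)
  have gapN: "(\<Sum>m\<in>{1..<M0 n + 1}. w m) = 0 \<or> 1 / real N \<le> (\<Sum>m\<in>{1..<M0 n + 1}. w m)"
    if "n0 \<le> n" "w \<in> HN n" for n w
  proof (rule discrete_weights_gap)
    show "w \<in> discrete_weights N (Mn n)" using that(2) by (simp add: HN_def)
    show "{1..<M0 n + 1} \<subseteq> {1..Mn n}" using T[OF that(1)] by auto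
  qed
  have gap\<delta>: "(\<Sum>m\<in>{1..<M0 n + 1}. w m) = 0 \<or> u\<delta> n \<le> (\<Sum>m\<in>{1..<M0 n + 1}. w m)"
    if "n0 \<le> n" "w \<in> H\<delta> n" for n w
    using that by (auto simp: H\<delta>_def delta_weights_def u\<delta>_def)
  have u\<delta>: "0 < u\<delta> n" if "0 < n" for n using that \<delta> by (simp add: u\<delta>_def)
  note limit = tendsto_prob_true_model_optimal[OF errors models truth C1 \<kappa>0, unfolded folds]

  \<comment> \<open>For discrete weights the lower bound \<open>1/N\<close> is constant and drops out of both rates.\<close>
  have limN: "(\<lambda>n. \<P>(\<omega> in M. (INF w\<in>HN n. L n w \<omega>) = L n (wT n) \<omega>)) \<longlonglongrightarrow> 1"
    if "(\<lambda>n. d n / (real n * \<eta> n)) \<longlonglongrightarrow> 0" "(\<lambda>n. real (M0 n) / (real n * (\<eta> n)\<^sup>2)) \<longlonglongrightarrow> 0"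
  proof (rule limit[where H = HN and u = "\<lambda>_. 1 / real N"])
    show "(\<lambda>n. (real (k n (M0 n + 1)) - real (k n 1)) / (real n * \<eta> n * (1 / real N))) \<longlonglongrightarrow> 0"
      using tendsto_mult_right_zero[OF that(1), of "real N"] by (simp add: d_def mult_ac)
    show "(\<lambda>n. real (M0 n) / (real n * (\<eta> n)\<^sup>2 * (1 / real N)\<^sup>2)) \<longlonglongrightarrow> 0"
      using tendsto_mult_right_zero[OF that(2), of "(real N)\<^sup>2"] by (simp add: power_divide mult_ac)
  qed ((rule HN gapN; assumption) | (insert N, simp))+

  have lim\<delta>: "(\<lambda>n. \<P>(\<omega> in M. (INF w\<in>H\<delta> n. L n w \<omega>) = L n (wT n) \<omega>)) \<longlonglongrightarrow> 1"
    if "(\<lambda>n. d n / (real n * \<eta> n * u\<delta> n)) \<longlonglongrightarrow> 0" "(\<lambda>n. real (M0 n) / (real n * (\<eta> n)\<^sup>2 * (u\<delta> n)\<^sup>2)) \<longlonglongrightarrow> 0"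
  proof (rule limit[where H = H\<delta> and u = u\<delta>])
  qed ((rule H\<delta> gap\<delta> u\<delta> that[unfolded d_def]; assumption?))+

  \<comment> \<open>With \<open>\<eta> n \<ge> c n powr (- \<tau>0)\<close> both denominators are bounded below by powers of \<open>n\<close>.\<close>
  have ii: "(\<lambda>n. \<P>(\<omega> in M. (INF w\<in>H\<delta> n. L n w \<omega>) = L n (wT n) \<omega>)) \<longlonglongrightarrow> 1"
    if c: "0 < c" "\<And>n. n0 \<le> n \<Longrightarrow> c * real n powr (- \<tau>0) \<le> \<eta> n"
      and dim: "(\<lambda>n. d n / real n powr (1 - 2 * \<tau>0)) \<longlonglongrightarrow> 0"
      and count: "(\<lambda>n. real (M0 n) / real n powr (1 - 4 * \<tau>0)) \<longlonglongrightarrow> 0" for c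
  proof (rule lim\<delta>)
    have bound: "c * \<delta> * real n powr (1 - 2 * \<tau>0) \<le> real n * \<eta> n * u\<delta> n"
      "c\<^sup>2 * \<delta>\<^sup>2 * real n powr (1 - 4 * \<tau>0) \<le> real n * (\<eta> n)\<^sup>2 * (u\<delta> n)\<^sup>2" if n: "n0 \<le> n" "0 < n" for n
    proof -
      let ?p = "real n powr (- \<tau>0)"
      have p2: "real n powr (1 - 2 * \<tau>0) = real n * ?p * ?p"
        using n by (simp add: powr_add[symmetric] powr_mult_base)
      have p4: "real n powr (1 - 4 * \<tau>0) = real n * ?p\<^sup>2 * ?p\<^sup>2"
        using n by (simp add: powr_add[symmetric] powr_mult_base power2_eq_square)
      have le: "c * ?p \<le> \<eta> n" by (rule c(2)[OF n(1)])
      have "real n * (c * ?p) * u\<delta> n \<le> real n * \<eta> n * u\<delta> n"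
        using le u\<delta>[OF n(2)] by (intro mult_right_mono mult_left_mono) auto
      then show "c * \<delta> * real n powr (1 - 2 * \<tau>0) \<le> real n * \<eta> n * u\<delta> n"
        unfolding p2 u\<delta>_def by (simp add: mult_ac)
      have "real n * (c * ?p)\<^sup>2 * (u\<delta> n)\<^sup>2 \<le> real n * (\<eta> n)\<^sup>2 * (u\<delta> n)\<^sup>2"
        using le c(1) by (intro mult_right_mono mult_left_mono power_mono) auto
      then show "c\<^sup>2 * \<delta>\<^sup>2 * real n powr (1 - 4 * \<tau>0) \<le> real n * (\<eta> n)\<^sup>2 * (u\<delta> n)\<^sup>2"
        unfolding p4 u\<delta>_def by (simp add: mult_ac power_mult_distrib)
    qed
    have ev: "\<forall>\<^sub>F n in sequentially. n0 \<le> n \<and> 0 < n"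
      using eventually_ge_at_top[of n0] eventually_gt_at_top[of 0] by eventually_elim simp
    show "(\<lambda>n. d n / (real n * \<eta> n * u\<delta> n)) \<longlonglongrightarrow> 0"
    proof (rule tendsto_sandwich[OF _ _ tendsto_const])
      show "\<forall>\<^sub>F n in sequentially. 0 \<le> d n / (real n * \<eta> n * u\<delta> n)"
        using ev by eventually_elim (use dims_facts u\<delta> in \<open>auto simp: d_def intro!: divide_nonneg_nonneg mult_nonneg_nonneg intro: less_imp_le\<close>)
      show "\<forall>\<^sub>F n in sequentially. d n / (real n * \<eta> n * u\<delta> n) \<le> 1 / (c * \<delta>) * (d n / real n powr (1 - 2 * \<tau>0))"
        using ev
      proof eventually_elim
        case (elim n)
        have "d n / (real n * \<eta> n * u\<delta> n) \<le> d n / (c * \<delta> * real n powr (1 - 2 * \<tau>0))"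
          using bound(1)[of n] elim c(1) \<delta> dims_facts(1)[of n] unfolding d_def
          by (intro divide_left_mono mult_pos_pos) (auto simp: u\<delta> dims_facts(3))
        then show ?case by simp
      qed
      show "(\<lambda>n. 1 / (c * \<delta>) * (d n / real n powr (1 - 2 * \<tau>0))) \<longlonglongrightarrow> 0"
        by (rule tendsto_mult_right_zero[OF dim])
    qed
    show "(\<lambda>n. real (M0 n) / (real n * (\<eta> n)\<^sup>2 * (u\<delta> n)\<^sup>2)) \<longlonglongrightarrow> 0"
    proof (rule tendsto_sandwich[OF _ _ tendsto_const])
      show "\<forall>\<^sub>F n in sequentially. real (M0 n) / (real n * (\<eta> n)\<^sup>2 * (u\<delta> n)\<^sup>2)
          \<le> 1 / (c\<^sup>2 * \<delta>\<^sup>2) * (real (M0 n) / real n powr (1 - 4 * \<tau>0))"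
        using ev
      proof eventually_elim
        case (elim n)
        have "real (M0 n) / (real n * (\<eta> n)\<^sup>2 * (u\<delta> n)\<^sup>2) \<le> real (M0 n) / (c\<^sup>2 * \<delta>\<^sup>2 * real n powr (1 - 4 * \<tau>0))"
          using bound(2)[of n] elim c(1) \<delta> u\<delta>[of n] dims_facts(3)[of n]
          by (intro divide_left_mono mult_pos_pos zero_less_power) auto
        then show ?case by simp
      qed
      show "(\<lambda>n. 1 / (c\<^sup>2 * \<delta>\<^sup>2) * (real (M0 n) / real n powr (1 - 4 * \<tau>0))) \<longlonglongrightarrow> 0"
        by (rule tendsto_mult_right_zero[OF count])
    qed simp
  qed

  \<comment> \<open>If \<open>k n (M0 n + 1) = K\<close>, then \<open>d n \<le> K\<close> and \<open>M0 n \<le> K\<close>, so only the growth of the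
    denominators matters.\<close>
  have fixed: "(\<lambda>n. d n / (real n * \<eta> n * u n)) \<longlonglongrightarrow> 0" "(\<lambda>n. real (M0 n) / (real n * (\<eta> n)\<^sup>2 * (u n)\<^sup>2)) \<longlonglongrightarrow> 0"
    if K: "\<And>n. n0 \<le> n \<Longrightarrow> k n (M0 n + 1) = K" and inv: "(\<lambda>n. inverse (\<eta> n)) \<in> O(\<lambda>_. 1)"
      and u: "\<And>n. 0 < n \<Longrightarrow> 0 < u n"
      and lim: "(\<lambda>n. inverse (real n * u n)) \<longlonglongrightarrow> 0" "(\<lambda>n. inverse (real n * (u n)\<^sup>2)) \<longlonglongrightarrow> 0"
    for u :: "nat \<Rightarrow> real" and K
  proof -
    obtain C where "\<forall>\<^sub>F n in sequentially. norm (inverse (\<eta> n)) \<le> C * norm (1::real)"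
      using inv by (elim landau_o.bigE)
    then have ev: "\<forall>\<^sub>F n in sequentially. n0 \<le> n \<and> 0 < n \<and> inverse (\<eta> n) \<le> C"
      using eventually_ge_at_top[of n0] eventually_gt_at_top[of 0]
      by eventually_elim (use dims_facts(3) in \<open>simp add: order_less_imp_le\<close>)
    show "(\<lambda>n. d n / (real n * \<eta> n * u n)) \<longlonglongrightarrow> 0"
    proof (rule tendsto_sandwich[OF _ _ tendsto_const])
      show "\<forall>\<^sub>F n in sequentially. 0 \<le> d n / (real n * \<eta> n * u n)"
        using ev by eventually_elim (use dims_facts u in \<open>auto simp: d_def intro!: divide_nonneg_nonneg mult_nonneg_nonneg intro: less_imp_le\<close>)
      show "\<forall>\<^sub>F n in sequentially. d n / (real n * \<eta> n * u n) \<le> real K * C * inverse (real n * u n)"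
        using ev
      proof eventually_elim
        case (elim n)
        have "d n * inverse (\<eta> n) * inverse (real n * u n) \<le> real K * C * inverse (real n * u n)"
          using elim K dims_facts(1,3)[of n] u[of n] unfolding d_def
          by (intro mult_right_mono mult_mono) (auto intro: less_imp_le)
        then show ?case by (simp add: field_simps)
      qed
      show "(\<lambda>n. real K * C * inverse (real n * u n)) \<longlonglongrightarrow> 0"
        by (rule tendsto_mult_right_zero[OF lim(1)])
    qed
    show "(\<lambda>n. real (M0 n) / (real n * (\<eta> n)\<^sup>2 * (u n)\<^sup>2)) \<longlonglongrightarrow> 0"
    proof (rule tendsto_sandwich[OF _ _ tendsto_const])
      show "\<forall>\<^sub>F n in sequentially. real (M0 n) / (real n * (\<eta> n)\<^sup>2 * (u n)\<^sup>2) \<le> real K * C\<^sup>2 * inverse (real n * (u n)\<^sup>2)"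
        using ev
      proof eventually_elim
        case (elim n)
        have "real (M0 n) * (inverse (\<eta> n))\<^sup>2 * inverse (real n * (u n)\<^sup>2) \<le> real K * C\<^sup>2 * inverse (real n * (u n)\<^sup>2)"
          using elim K[of n] dims_facts(2,3)[of n] u[of n]
          by (intro mult_right_mono mult_mono power_mono) (auto intro: less_imp_le)
        then show ?case by (simp add: field_simps)
      qed
      show "(\<lambda>n. real K * C\<^sup>2 * inverse (real n * (u n)\<^sup>2)) \<longlonglongrightarrow> 0"
        by (rule tendsto_mult_right_zero[OF lim(2)])
    qed simp
  qed

  note meas = iid_errors_measurable[OF errors]
  have L_meas: "\<forall>\<^sub>F n in sequentially. (\<lambda>\<omega>. L n (wT n) \<omega>) \<in> borel_measurable M"
    unfolding L_def using measurable_loss[OF meas] by simp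
  have HN_meas: "\<forall>\<^sub>F n in sequentially. (\<lambda>\<omega>. INF w\<in>HN n. L n w \<omega>) \<in> borel_measurable M"
    using eventually_ge_at_top[of n0]
    by eventually_elim (use HN(2) in \<open>auto simp: L_def intro!: measurable_INF_loss[OF meas]\<close>)
  have H\<delta>_meas: "\<forall>\<^sub>F n in sequentially. (\<lambda>\<omega>. INF w\<in>H\<delta> n. L n w \<omega>) \<in> borel_measurable M"
    using eventually_ge_at_top[of n0]
    by eventually_elim (use H\<delta>(2) in \<open>auto simp: L_def intro!: measurable_INF_loss[OF meas]\<close>)

  have ratioN: "tendsto_in_prob M (\<lambda>n \<omega>. loss_ratio (L n (wT n) \<omega>) (INF w\<in>HN n. L n w \<omega>)) 1"
    if "\<And>n. n0 \<le> n \<Longrightarrow> k n (M0 n + 1) = K" "(\<lambda>n. inverse (\<eta> n)) \<in> O(\<lambda>_. 1)" for K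
  proof (rule tendsto_in_prob_loss_ratio[OF limN L_meas HN_meas])
    show "(\<lambda>n. d n / (real n * \<eta> n)) \<longlonglongrightarrow> 0" "(\<lambda>n. real (M0 n) / (real n * (\<eta> n)\<^sup>2)) \<longlonglongrightarrow> 0"
      using fixed[OF that, of "\<lambda>_. 1"] lim_inverse_n by simp_all
  qed
  have ratio\<delta>: "tendsto_in_prob M (\<lambda>n \<omega>. loss_ratio (L n (wT n) \<omega>) (INF w\<in>H\<delta> n. L n w \<omega>)) 1"
    if "\<And>n. n0 \<le> n \<Longrightarrow> k n (M0 n + 1) = K" "(\<lambda>n. inverse (\<eta> n)) \<in> O(\<lambda>_. 1)" "\<tau>0 < 1 / 2" for K
  proof (rule tendsto_in_prob_loss_ratio[OF lim\<delta> L_meas H\<delta>_meas])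
    \<comment> \<open>The second limit needs \<open>\<tau>0 < 1/2\<close>: its denominator grows like \<open>n powr (1 - 2 * \<tau>0)\<close>.\<close>
    have "(\<lambda>n. inverse (real n * u\<delta> n)) \<longlonglongrightarrow> 0" "(\<lambda>n. inverse (real n * (u\<delta> n)\<^sup>2)) \<longlonglongrightarrow> 0"
      unfolding u\<delta>_def using \<delta> \<tau>0 that(3) by real_asymp+
    then show "(\<lambda>n. d n / (real n * \<eta> n * u\<delta> n)) \<longlonglongrightarrow> 0"
      "(\<lambda>n. real (M0 n) / (real n * (\<eta> n)\<^sup>2 * (u\<delta> n)\<^sup>2)) \<longlonglongrightarrow> 0"
      using fixed[OF that(1,2) u\<delta>] by auto
  qed
  show ?thesis
    using limN ii ratioN ratio\<delta> unfolding d_def by blast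
qed

end
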